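(* Let $R$ be a Dedekind domain with field of fractions $K$, let $n\ge1$, and let $\underline{S}=S_1\times\cdots\times S_n$ with each $S_j\subseteq R$, such that $I(\underline{S})=\{0\}$. Let $\mathbf{m}\in\mathbb{W}^n$, $k\in\mathbb{W}$. (1) Let $f\in R[\underline{x}]$ be a primitive polynomial of type $(\mathbf{m},k)$. Put $I=\operatorname{lcm}(d(\underline{S},f),\Gamma_{\mathbf{m},k}(\underline{S}))$, for each $j=1,\dots,n$ let $\{a_{i,j}\}_{i\ge0}$ be an $I$-ordering of $S_j$, put $B_{\mathbf{i}}(\underline{x})=\prod_{j=1}^n\prod_{t=0}^{i_j-1}(x_j-a_{t,j})$ for $\mathbf{i}\in\mathbb{W}^n$, and let $b(\mathbf{i})\in R$ be the coefficients in the expansion $$f(\underline{x})=\sum_{\substack{\mathbf{0}\le\mathbf{i}\le\mathbf{m}\\|\mathbf{i}|\le k}}b(\mathbf{i})B_{\mathbf{i}}(\underline{x}).$$ Then $d(\underline{S},f)$ is the ideal generated by all the ideals $b(\mathbf{i})\,\Gamma_{\mathbf{i},|\mathbf{i}|}(\underline{S})$ with $\mathbf{0}\le\mathbf{i}\le\mathbf{m}$, $|\mathbf{i}|\le k$. (2) Consequently, for every primitive $f\in R[\underline{x}]$ of type $(\mathbf{m},k)$, $d(\underline{S},f)$ divides $\Gamma_{\mathbf{m},k}(\underline{S})$, and this is sharp: if polynomials of type $(\mathbf{m},k)$ exist (i.e. $\max_i m_i\le k\le m_1+\cdots+m_n$), equality holds for some primitive $f$ of type $(\mathbf{m},k)$.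 (3) Conversely, if polynomials of type $(\mathbf{m},k)$ exist, then for each ideal $J$ dividing $\Gamma_{\mathbf{m},k}(\underline{S})$ there exists a primitive polynomial $f\in R[\underline{x}]$ of type $(\mathbf{m},k)$ with $d(\underline{S},f)=J$.
   Context: $\mathbb{W}$ is the set of non-negative integers; $\underline{x}=(x_1,\dots,x_n)$. A polynomial in $R[\underline{x}]$ is primitive if its coefficients generate the unit ideal. $\deg(f)\in\mathbb{W}^n$ is the $n$-tuple of partial degrees of $f$, $\mathrm{tdeg}(f)$ its total degree; $f$ is of type $(\mathbf{m},k)$ if $\deg(f)=\mathbf{m}$, $\mathrm{tdeg}(f)=k$; order on $\mathbb{W}^n$ is componentwise; $|\mathbf{i}|=i_1+\cdots+i_n$. $I(\underline{S})=\{f\in K[\underline{x}]:f(\underline{S})=0\}$ (for a product set, $I(\underline{S})=\{0\}$ means each $S_j$ is infinite). The fixed divisor $d(\underline{S},f)$ is the ideal of $R$ generated by $\{f(\underline{s}):\underline{s}\in\underline{S}\}$. $\mathrm{Int}_{\mathbf{m},k}(\underline{S},R)=\{f\in K[\underline{x}]: f(\underline{S})\subseteq R,\ \deg(f)\le\mathbf{m},\ \mathrm{tdeg}(f)\le k\}$ (including $0$), and $\Gamma_{\mathbf{m},k}(\underline{S})=\{a\in R: a\,\mathrm{Int}_{\mathbf{m},k}(\underline{S},R)\subseteq R[\underline{x}]\}$, an ideal of $R$. For ideals, $A$ divides $B$ means $B\subseteq A$; lcm is intersection. For a nonzero prime ideal $P$ with valuation $\nu_P$ and $T\subseteq R$ infinite,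 a $P$-ordering of $T$ is a sequence $a_0,a_1,\dots$ in $T$ such that for each $r\ge1$, $a_r$ minimizes $\nu_P\big(\prod_{i<r}(a-a_i)\big)$ over $a\in T$. For a nonzero ideal $I=\prod_{i=1}^rP_i^{e_i}$ (prime factorization), an $I$-ordering of $T$ is a sequence $\{a_j\}_{j\ge0}$ in $R$ which, for each $i=1,\dots,r$, is termwise congruent modulo $P_i^{e_i+1}$ to some $P_i$-ordering of $T$. *)

theory Defs
  imports
    "HOL-Computational_Algebra.Computational_Algebra"
    "HOL-Library.Poly_Mapping"
    "HOL-Library.Set_Algebras"
    "HOL-Library.Extended_Nat"
begin

section \<open>Ideals and Dedekind domains\<close>

text \<open>The ideals of a commutative ring \<open>'a\<close> are the submodules of \<open>'a\<close>: \<open>ideal.subspace I\<close>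
  says that \<open>I\<close> is an ideal, and \<open>ideal.span X\<close> is the ideal generated by \<open>X\<close>.\<close>

global_interpretation ideal: module "(*) :: 'a::comm_ring_1 \<Rightarrow> 'a \<Rightarrow> 'a"
  by unfold_locales (simp_all add: algebra_simps)

definition prime_ideal :: "'a::comm_ring_1 set \<Rightarrow> bool" where
  "prime_ideal P \<longleftrightarrow> ideal.subspace P \<and> P \<noteq> UNIV \<and> (\<forall>x y. x * y \<in> P \<longrightarrow> x \<in> P \<or> y \<in> P)"

definition maximal_ideal :: "'a::comm_ring_1 set \<Rightarrow> bool" where
  "maximal_ideal M \<longleftrightarrow> ideal.subspace M \<and> M \<noteq> UNIV \<and>
     (\<forall>J. ideal.subspace J \<and> M \<subseteq> J \<longrightarrow> J = M \<or> J = UNIV)"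

text \<open>Noetherian, integrally closed in its field of fractions, of dimension at most one. Fields
  are included.\<close>

definition dedekind_domain :: "'a::idom itself \<Rightarrow> bool" where
  "dedekind_domain _ \<longleftrightarrow>
     (\<forall>I :: 'a set. ideal.subspace I \<longrightarrow> (\<exists>A. finite A \<and> I = ideal.span A)) \<and>
     (\<forall>(p :: 'a poly) x. lead_coeff p = 1 \<and> poly (fract_poly p) x = 0 \<longrightarrow> x \<in> range to_fract) \<and>
     (\<forall>P :: 'a set. prime_ideal P \<and> P \<noteq> {0} \<longrightarrow> maximal_ideal P)"

text \<open>The product of finitely many ideals is the ideal generated by the products of their elements.
  Products and powers of sets below are the elementwise ones, so \<open>ideal.span (P ^ e)\<close> is the
  \<open>e\<close>-th power of the ideal \<open>P\<close> (for \<open>e = 0\<close> it is the span of \<open>{1}\<close>, the unit ideal).\<close>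

definition ideal_power :: "'a::comm_ring_1 set \<Rightarrow> nat \<Rightarrow> 'a set" where
  "ideal_power P e = ideal.span (P ^ e)"

text \<open>The \<open>P\<close>-adic valuation: the largest \<open>e\<close> with \<open>x \<in> P\<^sup>e\<close>, and \<open>\<infinity>\<close> at \<open>0\<close>.\<close>

definition ideal_valuation :: "'a::comm_ring_1 set \<Rightarrow> 'a \<Rightarrow> enat" where
  "ideal_valuation P x = (SUP e \<in> {e. x \<in> ideal_power P e}. enat e)"

definition P_ordering :: "'a::comm_ring_1 set \<Rightarrow> 'a set \<Rightarrow> (nat \<Rightarrow> 'a) \<Rightarrow> bool" where
  "P_ordering P T c \<longleftrightarrow> (\<forall>r. c r \<in> T) \<and>
     (\<forall>r\<ge>1. \<forall>x\<in>T. ideal_valuation P (\<Prod>i<r. c r - c i) \<le> ideal_valuation P (\<Prod>i<r. x - c i))"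

text \<open>The family \<open>P\<close>, \<open>e\<close> below is the factorization of \<open>I\<close> into powers of distinct nonzero prime
  ideals, so \<open>I\<close> is necessarily nonzero in a domain.\<close>

definition I_ordering :: "'a::comm_ring_1 set \<Rightarrow> 'a set \<Rightarrow> (nat \<Rightarrow> 'a) \<Rightarrow> bool" where
  "I_ordering I T a \<longleftrightarrow>
     (\<exists>(r :: nat) P (e :: nat \<Rightarrow> nat).
        (\<forall>i<r. prime_ideal (P i) \<and> P i \<noteq> {0} \<and> e i \<ge> 1) \<and> inj_on P {..<r} \<and>
        I = ideal.span (\<Prod>i<r. P i ^ e i) \<and>
        (\<forall>i<r. \<exists>c. P_ordering (P i) T c \<and> (\<forall>j. a j - c j \<in> ideal_power (P i) (e i + 1))))"

section \<open>Polynomials in several variables\<close>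

text \<open>The variables are indexed by a finite type \<open>'n\<close>; a polynomial is a finitely supported map
  from exponent vectors to coefficients.\<close>

type_synonym ('n, 'a) mpoly = "('n \<Rightarrow>\<^sub>0 nat) \<Rightarrow>\<^sub>0 'a"

definition Const :: "'a \<Rightarrow> ('n, 'a::zero) mpoly" where
  "Const c = Poly_Mapping.single 0 c"

definition Var :: "'n \<Rightarrow> ('n, 'a::zero_neq_one) mpoly" where
  "Var j = Poly_Mapping.single (Poly_Mapping.single j 1) 1"

definition eval :: "('n::finite \<Rightarrow> 'a) \<Rightarrow> ('n, 'a::comm_semiring_1) mpoly \<Rightarrow> 'a" where
  "eval s f = (\<Sum>\<alpha>\<in>Poly_Mapping.keys f. Poly_Mapping.lookup f \<alpha> *
     (\<Prod>j\<in>UNIV. s j ^ Poly_Mapping.lookup \<alpha> j))"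

text \<open>The zero polynomial is given degree \<open>0\<close>.\<close>

definition mdeg :: "('n, 'a::zero) mpoly \<Rightarrow> 'n \<Rightarrow> nat" where
  "mdeg f = (\<lambda>j. Max (insert 0 ((\<lambda>\<alpha>. Poly_Mapping.lookup \<alpha> j) ` Poly_Mapping.keys f)))"

definition tdeg :: "('n::finite, 'a::zero) mpoly \<Rightarrow> nat" where
  "tdeg f = Max (insert 0 ((\<lambda>\<alpha>. \<Sum>j\<in>UNIV. Poly_Mapping.lookup \<alpha> j) ` Poly_Mapping.keys f))"

definition of_type :: "('n::finite, 'a::zero) mpoly \<Rightarrow> ('n \<Rightarrow> nat) \<Rightarrow> nat \<Rightarrow> bool" where
  "of_type f m k \<longleftrightarrow> mdeg f = m \<and> tdeg f = k"

definition primitive :: "('n, 'a::comm_ring_1) mpoly \<Rightarrow> bool" where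
  "primitive f \<longleftrightarrow> ideal.span (Poly_Mapping.lookup f ` Poly_Mapping.keys f) = UNIV"

text \<open>The polynomials over the field of fractions whose coefficients lie in the ring.\<close>

definition integral_mpolys :: "('n, 'a::idom fract) mpoly set" where
  "integral_mpolys = {g. \<forall>\<alpha>. Poly_Mapping.lookup g \<alpha> \<in> range to_fract}"

section \<open>Integer-valued polynomials and fixed divisors\<close>

text \<open>A product set \<open>\<Prod>\<^sub>j S\<^sub>j\<close> is given by the family \<open>S\<close> of its factors; its points are the elements
  of \<open>Pi UNIV S\<close>.\<close>

definition vanishing_ideal :: "('n::finite \<Rightarrow> 'a::idom set) \<Rightarrow> ('n, 'a fract) mpoly set" where
  "vanishing_ideal S = {g. \<forall>s\<in>Pi UNIV S. eval (\<lambda>j. to_fract (s j)) g = 0}"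

definition fixed_divisor ::
    "('n::finite \<Rightarrow> 'a::comm_ring_1 set) \<Rightarrow> ('n, 'a) mpoly \<Rightarrow> 'a set" where
  "fixed_divisor S f = ideal.span ((\<lambda>s. eval s f) ` Pi UNIV S)"

definition Int_mpolys ::
    "('n::finite \<Rightarrow> nat) \<Rightarrow> nat \<Rightarrow> ('n \<Rightarrow> 'a::idom set) \<Rightarrow> ('n, 'a fract) mpoly set" where
  "Int_mpolys m k S = {g. (\<forall>s\<in>Pi UNIV S. eval (\<lambda>j. to_fract (s j)) g \<in> range to_fract) \<and>
     mdeg g \<le> m \<and> tdeg g \<le> k}"

definition Gamma_ideal ::
    "('n::finite \<Rightarrow> nat) \<Rightarrow> nat \<Rightarrow> ('n \<Rightarrow> 'a::idom set) \<Rightarrow> 'a set" where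
  "Gamma_ideal m k S = {a. \<forall>g\<in>Int_mpolys m k S. Const (to_fract a) * g \<in> integral_mpolys}"

definition basis_mpoly ::
    "('n::finite \<Rightarrow> nat \<Rightarrow> 'a::comm_ring_1) \<Rightarrow> ('n \<Rightarrow> nat) \<Rightarrow> ('n, 'a) mpoly" where
  "basis_mpoly a i = (\<Prod>j\<in>UNIV. \<Prod>t<i j. Var j - Const (a j t))"

definition multi_indices :: "('n::finite \<Rightarrow> nat) \<Rightarrow> nat \<Rightarrow> ('n \<Rightarrow> nat) set" where
  "multi_indices m k = {i. i \<le> m \<and> (\<Sum>j\<in>UNIV. i j) \<le> k}"

text \<open>Divisibility of ideals: to divide is to contain.\<close>

definition ideal_dvd :: "'a set \<Rightarrow> 'a set \<Rightarrow> bool" where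
  "ideal_dvd A B \<longleftrightarrow> B \<subseteq> A"

end

theory Submission
  imports Defs
begin

text \<open>Localizing at a prime \<open>P\<close> is expressed inside \<open>R\<close>: an element belongs to \<open>I R\<^sub>P\<close> if some
  \<open>s \<notin> P\<close> multiplies it into \<open>I\<close>, and every nonzero ideal has a local generator.

  If \<open>f\<close> is primitive and \<open>d\<close> locally generates \<open>d(S, f)\<close>, then \<open>f / d\<close> is integer-valued up to a local
  unit, so \<open>a / d\<close> is locally integral for \<open>a \<in> \<Gamma>\<close>; hence \<open>\<Gamma> \<subseteq> d(S, f)\<close>. Conversely, the polynomials
  with all values in \<open>\<Gamma>\<close> have no common prime factor, and as they include \<open>\<Gamma> R[x]\<close> in the given
  degrees, prime avoidance finds a primitive one; its fixed divisor is \<open>\<Gamma>\<close>. An ideal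
  \<open>J = \<Gamma> + (c)\<close> is reached by adding \<open>c\<close> to it.

  For the expansion, a \<open>P\<close>-ordering makes the values of the basis polynomials at the nodes a
  triangular matrix whose diagonal entry at \<open>i\<close> locally generates both \<open>\<Gamma>\<^sub>i\<close> and the ideal of all
  values of \<open>B\<^sub>i\<close>. The two inclusions follow by evaluating \<open>f\<close> on \<open>S\<close> and at the nodes.\<close>

section \<open>Localization of ideals\<close>

(* As a simplification rule, scale_scale undoes mult.assoc and makes the simplifier loop. *)
declare ideal.scale_scale [simp del]

text \<open>The exponent \<open>e i + 1\<close> in \<open>I_ordering\<close> is what the expansion
  rests on. Points that agree modulo \<open>P \<Gamma>\<close> give diagonal entries that differ by
  an element of \<open>P\<close> times the entry of the \<open>P\<close>-ordering, because
  \<open>\<Gamma>\<close> lies locally in each ideal generated by such an entry; so the entries of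
  the two families agree up to a local unit. Agreement modulo \<open>\<Gamma>\<close> alone would
  not exclude that an entry for \<open>a\<close> has larger valuation. The points \<open>a\<close>
  may lie outside \<open>S\<close>, but values of \<open>f\<close> there are still controlled since
  \<open>\<Gamma> \<subseteq> d(S, f)\<close>; the same inclusion identifies the lcm with
  \<open>\<Gamma>\<close>.

  The obstacle to finding a primitive polynomial is that avoidance treats only finitely many primes
  at a time, while primitivity concerns all of them. The primes containing \<open>\<Gamma>\<close>
  are finitely many, and so are those containing one fixed nonzero coefficient.

  The ideal \<open>{0}\<close> counts as a prime. Localizing there makes every nonzero element a
  unit, which is how the infinite factors \<open>S j\<close> yield
  \<open>\<Gamma> \<noteq> {0}\<close>.\<close>

lemma prime_idealD:
  assumes "prime_ideal P"
  shows "ideal.subspace P" "1 \<notin> P" "x * y \<in> P \<Longrightarrow> x \<in> P \<or> y \<in> P"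
proof -
  show "ideal.subspace P" "x * y \<in> P \<Longrightarrow> x \<in> P \<or> y \<in> P"
    using assms unfolding prime_ideal_def by auto
  show "1 \<notin> P"
  proof
    assume "1 \<in> P"
    then have "x \<in> P" for x
      using assms ideal.subspace_scale[of P 1 x] unfolding prime_ideal_def by simp
    then show False using assms unfolding prime_ideal_def by auto
  qed
qed

lemma prime_ideal_zero: "prime_ideal P \<Longrightarrow> 0 \<in> P"
  using ideal.subspace_0 prime_idealD(1) by blast

lemma prime_ideal_mult:
  assumes "prime_ideal P" "x \<notin> P" "y \<notin> P"
  shows "x * y \<notin> P"
  using prime_idealD(3)[OF assms(1)] assms(2,3) by blast

lemma prime_ideal_power:
  assumes "prime_ideal P" "x \<notin> P"
  shows "x ^ n \<notin> P"
  using assms by (induction n) (auto simp: prime_idealD(2) prime_ideal_mult)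

lemma prime_ideal_prod:
  assumes "prime_ideal P" "\<And>i. i \<in> F \<Longrightarrow> f i \<notin> P"
  shows "(\<Prod>i\<in>F. f i) \<notin> P"
  using assms by (induction F rule: infinite_finite_induct)
    (auto simp: prime_idealD(2) prime_ideal_mult)

lemma maximal_ideal_comaximal:
  assumes "maximal_ideal M" "x \<notin> M"
  obtains p r where "p \<in> M" "1 = p + r * x"
proof -
  have M: "ideal.subspace M" using assms unfolding maximal_ideal_def by auto
  have "M \<subseteq> ideal.span (insert x M)" "x \<in> ideal.span (insert x M)"
    using ideal.span_superset[of "insert x M"] by auto
  then have "ideal.span (insert x M) = UNIV"
    using assms unfolding maximal_ideal_def by (metis ideal.subspace_span)
  then obtain k where "1 - k * x \<in> ideal.span M"
    unfolding ideal.span_insert by auto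
  then have "1 - k * x \<in> M" using M by (metis ideal.span_eq_iff)
  then show ?thesis using that[of "1 - k * x" k] by simp
qed

lemma maximal_imp_prime_ideal:
  assumes "maximal_ideal M"
  shows "prime_ideal M"
  unfolding prime_ideal_def
proof (intro conjI allI impI)
  show M: "ideal.subspace M" and "M \<noteq> UNIV" using assms unfolding maximal_ideal_def by auto
  fix x y assume xy: "x * y \<in> M"
  show "x \<in> M \<or> y \<in> M"
  proof (rule disjCI)
    assume "y \<notin> M"
    then obtain p r where p: "p \<in> M" "1 = p + r * y"
      using maximal_ideal_comaximal[OF assms] by blast
    have "x = x * (p + r * y)" using p(2) by simp
    also have "\<dots> = x * p + r * (x * y)" by (simp add: algebra_simps)
    finally have "x = x * p + r * (x * y)" .
    then show "x \<in> M" using M p(1) xy ideal.subspace_add ideal.subspace_scale by metis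
  qed
qed

lemma maximal_ideal_subset_eq:
  assumes "maximal_ideal M" "prime_ideal P" "M \<subseteq> P"
  shows "P = M"
  using assms unfolding maximal_ideal_def prime_ideal_def by auto

definition loc :: "'a::comm_ring_1 set \<Rightarrow> 'a set \<Rightarrow> 'a set" where
  "loc P A = {x. \<exists>s. s \<notin> P \<and> s * x \<in> A}"

lemma locI: "s \<notin> P \<Longrightarrow> s * x \<in> A \<Longrightarrow> x \<in> loc P A"
  unfolding loc_def by auto

lemma locE:
  assumes "x \<in> loc P A"
  obtains s where "s \<notin> P" "s * x \<in> A"
  using assms unfolding loc_def by auto

lemma loc_superset:
  assumes "prime_ideal P"
  shows "A \<subseteq> loc P A"
  using prime_idealD(2)[OF assms] locI[of 1 P _ A] by auto

lemma loc_mono: "A \<subseteq> B \<Longrightarrow> loc P A \<subseteq> loc P B"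
  unfolding loc_def by auto

lemma subspace_loc:
  assumes "prime_ideal P" "ideal.subspace A"
  shows "ideal.subspace (loc P A)"
proof (rule ideal.subspaceI)
  show "0 \<in> loc P A"
    using loc_superset[OF assms(1)] ideal.subspace_0[OF assms(2)] by auto
next
  fix x y assume "x \<in> loc P A" "y \<in> loc P A"
  then obtain s t where st: "s \<notin> P" "s * x \<in> A" "t \<notin> P" "t * y \<in> A" by (auto elim!: locE)
  have "(s * t) * (x + y) = t * (s * x) + s * (t * y)" by (simp add: algebra_simps)
  also have "\<dots> \<in> A" using st
    by (intro ideal.subspace_add[OF assms(2)] ideal.subspace_scale[OF assms(2), of "_ * _"])
  finally show "x + y \<in> loc P A" using st prime_ideal_mult[OF assms(1)] by (intro locI)
next
  fix c x assume "x \<in> loc P A"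
  then obtain s where s: "s \<notin> P" "s * x \<in> A" by (auto elim!: locE)
  have "s * (c * x) = c * (s * x)" by (simp add: algebra_simps)
  also have "\<dots> \<in> A" using s by (intro ideal.subspace_scale[OF assms(2), of "s * x"])
  finally show "c * x \<in> loc P A" using s by (intro locI)
qed

lemma loc_loc:
  assumes "prime_ideal P"
  shows "loc P (loc P A) = loc P A"
proof
  show "loc P (loc P A) \<subseteq> loc P A"
  proof
    fix x assume "x \<in> loc P (loc P A)"
    then obtain s t where "s \<notin> P" "t \<notin> P" "t * (s * x) \<in> A" by (auto elim!: locE)
    then show "x \<in> loc P A"
      using prime_ideal_mult[OF assms, of t s] by (intro locI[of "t * s"]) (auto simp: mult.assoc)
  qed
  show "loc P A \<subseteq> loc P (loc P A)" by (rule loc_superset[OF assms])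
qed

lemma loc_scale:
  assumes "prime_ideal P" "s \<notin> P" "s * x \<in> loc P A"
  shows "x \<in> loc P A"
  using locI[OF assms(2,3)] loc_loc[OF assms(1)] by blast

lemma subspace_principal: "ideal.subspace {x. d dvd (x::'a::comm_ring_1)}"
  by (rule ideal.subspaceI) auto

section \<open>Dedekind domains\<close>

context
  assumes dedekind: "dedekind_domain TYPE('a::idom)"
begin

lemma ideal_finitely_generated:
  assumes "ideal.subspace (A :: 'a set)"
  obtains G where "finite G" "A = ideal.span G"
  using dedekind assms unfolding dedekind_domain_def by auto

lemma nonzero_prime_maximal:
  assumes "prime_ideal (P :: 'a set)" "P \<noteq> {0}"
  shows "maximal_ideal P"
  using dedekind assms unfolding dedekind_domain_def by auto

lemma prime_ideal_subset_eq:
  assumes "prime_ideal (P :: 'a set)" "P \<noteq> {0}" "prime_ideal Q" "P \<subseteq> Q"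
  shows "Q = P"
  using maximal_ideal_subset_eq nonzero_prime_maximal assms by blast

text \<open>The ascending chain condition: the union of a chain is an ideal with finitely many
  generators, all in one member of the chain, so that member is the union and Zorn's lemma applies
  within \<open>\<A>\<close>.\<close>

lemma ideal_family_maximal:
  assumes "\<A> \<noteq> {}" "\<And>A. A \<in> \<A> \<Longrightarrow> ideal.subspace (A :: 'a set)"
  obtains M where "M \<in> \<A>" "\<forall>X\<in>\<A>. M \<subseteq> X \<longrightarrow> X = M"
proof -
  have "\<Union>\<C> \<in> \<A>" if C: "\<C> \<noteq> {}" "subset.chain \<A> \<C>" for \<C>
  proof -
    have CA: "\<C> \<subseteq> \<A>" and lin: "\<And>X Y. X \<in> \<C> \<Longrightarrow> Y \<in> \<C> \<Longrightarrow> X \<subseteq> Y \<or> Y \<subseteq> X"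
      using C(2) unfolding subset.chain_def by auto
    have "ideal.subspace (\<Union>\<C>)"
    proof (rule ideal.subspaceI)
      show "0 \<in> \<Union>\<C>" using C(1) CA assms(2) ideal.subspace_0 by fastforce
    next
      fix x y assume "x \<in> \<Union>\<C>" "y \<in> \<Union>\<C>"
      then obtain X where "X \<in> \<C>" "x \<in> X" "y \<in> X" using lin by blast
      then show "x + y \<in> \<Union>\<C>" using CA assms(2) ideal.subspace_add by blast
    next
      fix c x assume "x \<in> \<Union>\<C>"
      then show "c * x \<in> \<Union>\<C>" using CA assms(2) ideal.subspace_scale by blast
    qed
    then obtain G where G: "finite G" "\<Union>\<C> = ideal.span G" by (rule ideal_finitely_generated)
    then have "G \<subseteq> \<Union>\<C>" using ideal.span_superset by blast
    then obtain X where X: "X \<in> \<C>" "G \<subseteq> X"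
      using finite_subset_Union_chain[OF G(1) _ C] by blast
    have "ideal.span G \<subseteq> X" using X CA assms(2) by (intro ideal.span_minimal) auto
    then have "\<Union>\<C> = X" using G(2) X(1) by auto
    then show ?thesis using X(1) CA by auto
  qed
  then show ?thesis using subset_Zorn_nonempty[OF assms(1)] that by metis
qed

lemma proper_ideal_subset_prime:
  assumes "ideal.subspace (A :: 'a set)" "A \<noteq> UNIV"
  obtains M where "prime_ideal M" "A \<subseteq> M"
proof -
  let ?F = "{J. ideal.subspace J \<and> A \<subseteq> J \<and> J \<noteq> UNIV}"
  have "?F \<noteq> {}" using assms by auto
  moreover have "ideal.subspace J" if "J \<in> ?F" for J using that by blast
  ultimately obtain M where M: "M \<in> ?F" "\<forall>X\<in>?F. M \<subseteq> X \<longrightarrow> X = M"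
    by (rule ideal_family_maximal)
  then have "maximal_ideal M" unfolding maximal_ideal_def by blast
  then show ?thesis using that M(1) maximal_imp_prime_ideal by blast
qed

text \<open>The multipliers \<open>s\<close> with \<open>s * x \<in> A\<close> form an ideal. Were
  it proper, a prime \<open>P\<close> would contain it, leaving no multiplier outside
  \<open>P\<close>. Inclusions of ideals can thus be checked one prime at a time.\<close>

lemma mem_ideal_local:
  assumes "ideal.subspace (A :: 'a set)" "\<And>P. prime_ideal P \<Longrightarrow> x \<in> loc P A"
  shows "x \<in> A"
proof (rule ccontr)
  assume x: "x \<notin> A"
  have "ideal.subspace {s. s * x \<in> A}"
    using assms(1) unfolding ideal.subspace_def by (auto simp: distrib_right mult.assoc)
  moreover have "{s. s * x \<in> A} \<noteq> UNIV" using x by (metis UNIV_I mem_Collect_eq mult_1)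
  ultimately obtain P where P: "prime_ideal P" "{s. s * x \<in> A} \<subseteq> P"
    by (rule proper_ideal_subset_prime)
  then show False using assms(2)[OF P(1)] by (auto elim!: locE)
qed

text \<open>Noetherian induction: a maximal counterexample would be a prime ideal.\<close>

lemma ideal_contains_prime_product:
  assumes "ideal.subspace (A :: 'a set)" "A \<noteq> {0}"
  obtains Qs where "\<And>Q. Q \<in># Qs \<Longrightarrow> prime_ideal Q \<and> Q \<noteq> {0}" "prod_mset Qs \<subseteq> A"
proof -
  define good where "good A \<longleftrightarrow> (\<exists>Qs. (\<forall>Q. Q \<in># Qs \<longrightarrow> prime_ideal Q \<and> Q \<noteq> {0}) \<and> prod_mset Qs \<subseteq> A)"
    for A :: "'a set"
  have "good A"
  proof (rule ccontr)
    let ?F = "{J. ideal.subspace J \<and> J \<noteq> {0} \<and> \<not> good J}"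
    assume "\<not> good A"
    then have "?F \<noteq> {}" using assms by blast
    moreover have "ideal.subspace J" if "J \<in> ?F" for J using that by blast
    ultimately obtain M where M: "M \<in> ?F" "\<forall>X\<in>?F. M \<subseteq> X \<longrightarrow> X = M"
      by (rule ideal_family_maximal)
    then have subM: "ideal.subspace M" by blast
    have "M \<noteq> UNIV"
    proof
      assume "M = UNIV"
      then have "good M" unfolding good_def by (intro exI[of _ "{#}"]) simp
      then show False using M(1) by blast
    qed
    moreover have "\<not> prime_ideal M"
    proof
      assume "prime_ideal M"
      then have "good M" unfolding good_def using M(1) by (intro exI[of _ "{#M#}"]) (auto simp del: set_one)
      then show False using M(1) by blast
    qed
    \<comment> \<open>Adjoining \<open>x\<close> or \<open>y\<close> enlarges \<open>M\<close>
      properly, so both larger ideals contain prime products; since \<open>x * y \<in> M\<close>,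
      the product of the two lies in \<open>M\<close>.\<close>
    ultimately obtain x y where xy: "x * y \<in> M" "x \<notin> M" "y \<notin> M"
      using subM unfolding prime_ideal_def by blast
    have *: "good (ideal.span (insert z M))" if z: "z \<notin> M" for z
    proof (rule ccontr)
      have sup: "insert z M \<subseteq> ideal.span (insert z M)" by (rule ideal.span_superset)
      assume "\<not> good (ideal.span (insert z M))"
      moreover have "ideal.span (insert z M) \<noteq> {0}"
        using sup z M(1) ideal.subspace_0 by fastforce
      ultimately have "ideal.span (insert z M) \<in> ?F" by blast
      then have "ideal.span (insert z M) = M" using M(2) sup by blast
      then show False using sup z by blast
    qed
    obtain Q1 where Q1: "\<forall>Q. Q \<in># Q1 \<longrightarrow> prime_ideal Q \<and> Q \<noteq> {0}"
      "prod_mset Q1 \<subseteq> ideal.span (insert x M)" using *[OF xy(2)] unfolding good_def by blast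
    obtain Q2 where Q2: "\<forall>Q. Q \<in># Q2 \<longrightarrow> prime_ideal Q \<and> Q \<noteq> {0}"
      "prod_mset Q2 \<subseteq> ideal.span (insert y M)" using *[OF xy(3)] unfolding good_def by blast
    have "prod_mset Q1 * prod_mset Q2 \<subseteq> M"
    proof
      fix z assume "z \<in> prod_mset Q1 * prod_mset Q2"
      then obtain u v where uv: "u \<in> ideal.span (insert x M)" "v \<in> ideal.span (insert y M)"
        "z = u * v" using Q1(2) Q2(2) by (auto elim!: set_times_elim)
      then obtain k l where kl: "u - k * x \<in> M" "v - l * y \<in> M"
        unfolding ideal.span_breakdown_eq ideal.span_eq_iff[THEN iffD2, OF subM] by blast
      have "z = v * (u - k * x) + k * x * (v - l * y) + k * l * (x * y)"
        using uv(3) by (simp add: algebra_simps)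
      moreover have "\<dots> \<in> M"
        using subM by (intro ideal.subspace_add ideal.subspace_scale kl xy(1))
      ultimately show "z \<in> M" by simp
    qed
    then have "good M" unfolding good_def using Q1(1) Q2(1) by (intro exI[of _ "Q1 + Q2"]) auto
    then show False using M(1) by blast
  qed
  then show ?thesis using that unfolding good_def by blast
qed

end

section \<open>Products and powers of ideals, valuations, prime avoidance\<close>

lemma prod_sets_not_subset_prime:
  assumes "prime_ideal P" "finite F" "\<And>i. i \<in> F \<Longrightarrow> \<not> X i \<subseteq> P"
  obtains x where "x \<in> (\<Prod>i\<in>F. X i)" "x \<notin> P"
proof -
  have "\<exists>x. x \<in> (\<Prod>i\<in>F. X i) \<and> x \<notin> P"
    using assms(2,3)
  proof (induction F)
    case empty
    show ?case using prime_idealD(2)[OF assms(1)] by (intro exI[of _ 1]) simp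
  next
    case (insert i F)
    then obtain x y where "x \<in> (\<Prod>i\<in>F. X i)" "x \<notin> P" "y \<in> X i" "y \<notin> P" by blast
    then show ?case using insert(1,2) prime_ideal_mult[OF assms(1), of y x]
      by (intro exI[of _ "y * x"]) auto
  qed
  then show ?thesis using that by blast
qed

lemma prod_mset_not_subset_prime:
  assumes "prime_ideal P" "\<And>Q. Q \<in># Qs \<Longrightarrow> \<not> Q \<subseteq> P"
  shows "\<not> prod_mset Qs \<subseteq> P"
proof -
  have "\<exists>x. x \<in> prod_mset Qs \<and> x \<notin> P"
    using assms(2)
  proof (induction Qs)
    case empty
    show ?case using prime_idealD(2)[OF assms(1)] by (intro exI[of _ 1]) simp
  next
    case (add Q Qs)
    then obtain x y where "x \<in> prod_mset Qs" "x \<notin> P" "y \<in> Q" "y \<notin> P"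
      by (metis subsetI union_single_eq_member insert_iff set_mset_add_mset_insert)
    then show ?case using prime_ideal_mult[OF assms(1), of y x]
      by (intro exI[of _ "y * x"]) auto
  qed
  then show ?thesis by blast
qed

lemma subspace_ideal_power: "ideal.subspace (ideal_power P n)"
  unfolding ideal_power_def by (rule ideal.subspace_span)

lemma ideal_power_Suc_subset: "ideal_power P (Suc n) \<subseteq> ideal_power P n"
  unfolding ideal_power_def
proof (intro ideal.span_minimal subsetI)
  fix x assume "x \<in> P ^ Suc n"
  then obtain p y where "y \<in> P ^ n" "x = p * y" by (auto elim!: set_times_elim)
  then show "x \<in> ideal.span (P ^ n)" by (auto intro: ideal.span_scale ideal.span_base)
qed auto

lemma ideal_power_antimono: "m \<le> n \<Longrightarrow> ideal_power P n \<subseteq> ideal_power P m"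
  by (induction rule: dec_induct) (use ideal_power_Suc_subset in blast)+

lemma power_mem_set_power: "t \<in> P \<Longrightarrow> t ^ n \<in> P ^ n"
  by (induction n) auto

text \<open>Powers of a maximal ideal are primary: raising \<open>1 = p + r * w\<close> to the power
  \<open>n\<close> gives \<open>1 = p ^ n + q * w\<close>, and multiplying by \<open>x\<close>
  leaves two terms of \<open>ideal_power P n\<close>.\<close>

lemma maximal_ideal_power_cancel:
  assumes "maximal_ideal P" "w \<notin> P" "w * x \<in> ideal_power P n"
  shows "x \<in> ideal_power P n"
proof -
  obtain p r where p: "p \<in> P" "1 = p + r * w" using maximal_ideal_comaximal assms(1,2) by blast
  have "\<exists>q. (p + r * w) ^ n = p ^ n + q * w"
  proof (induction n)
    case (Suc n)
    then obtain q where "(p + r * w) ^ n = p ^ n + q * w" by blast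
    then show ?case by (intro exI[of _ "p * q + r * (p + r * w) ^ n"]) (simp add: algebra_simps)
  qed (auto intro: exI[of _ 0])
  then obtain q where "1 = p ^ n + q * w" using p(2) by (metis power_one)
  then have "x = (p ^ n + q * w) * x" by simp
  then have "x = x * p ^ n + q * (w * x)" by (simp add: algebra_simps)
  moreover have "x * p ^ n + q * (w * x) \<in> ideal_power P n"
    using assms(3) unfolding ideal_power_def
    by (intro ideal.span_add ideal.span_scale[of "p ^ n"] ideal.span_scale[of "w * x"]
        ideal.span_base[of "p ^ n"] power_mem_set_power p(1))
  ultimately show ?thesis by simp
qed

lemma ideal_valuation_eq:
  assumes "x \<in> ideal_power P e" "x \<notin> ideal_power P (Suc e)"
  shows "ideal_valuation P x = enat e"
proof -
  have "{n. x \<in> ideal_power P n} = {..e}"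
  proof (intro set_eqI iffI)
    fix n assume "n \<in> {n. x \<in> ideal_power P n}"
    then have "\<not> Suc e \<le> n" using assms(2) ideal_power_antimono by blast
    then show "n \<in> {..e}" by simp
  next
    fix n assume "n \<in> {..e}"
    then show "n \<in> {n. x \<in> ideal_power P n}" using assms(1) ideal_power_antimono by auto
  qed
  then show ?thesis unfolding ideal_valuation_def
    by (intro antisym SUP_least) (auto intro: SUP_upper2[of e])
qed

lemma ideal_valuation_zero: "ideal_valuation P 0 = \<infinity>"
proof -
  have "{n. 0 \<in> ideal_power P n} = UNIV"
    using ideal.subspace_0[OF subspace_ideal_power] by auto
  then have "enat n \<le> ideal_valuation P 0" for n
    unfolding ideal_valuation_def by (auto intro: SUP_upper)
  then show ?thesis by (metis enat.exhaust enat_ord_simps(1) not_less_eq_eq order_refl)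
qed

text \<open>Kept general because it serves both ideals of the ring and spans of basis
  polynomials.\<close>

lemma (in module) span_image_sum:
  assumes "finite A" "x \<in> span (f ` A)"
  obtains r where "x = (\<Sum>i\<in>A. scale (r i) (f i))"
proof -
  have "\<exists>r. x = (\<Sum>i\<in>A. scale (r i) (f i))" using assms
  proof (induction A arbitrary: x)
    case (insert a A)
    then obtain k where "x - scale k (f a) \<in> span (f ` A)"
      by (auto simp: span_breakdown_eq)
    then obtain r where r: "x - scale k (f a) = (\<Sum>i\<in>A. scale (r i) (f i))" using insert.IH by blast
    have "(\<Sum>i\<in>A. scale ((r(a := k)) i) (f i)) = (\<Sum>i\<in>A. scale (r i) (f i))"
      using insert.hyps by (intro sum.cong) auto
    then have "x = (\<Sum>i\<in>insert a A. scale ((r(a := k)) i) (f i))"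
      using insert.hyps r by (simp add: algebra_simps)
    then show ?case by blast
  qed simp
  then show ?thesis using that by blast
qed

lemma to_fract_power: "to_fract (x ^ n) = to_fract x ^ n"
  by (induction n) simp_all

text \<open>Prime avoidance for a coset \<open>x0 + X\<close>. The condition on
  \<open>scale p x\<close> makes \<open>X\<close> modulo \<open>W P\<close> a vector space over the
  residue field of \<open>P\<close>, so a correction \<open>scale u y\<close>, with \<open>u\<close>
  in all earlier primes but not in the new \<open>Q\<close>, disturbs nothing achieved before. It is
  applied to an ideal \<open>J\<close> modulo \<open>P J\<close>, to polynomials modulo those with
  all coefficients in \<open>P\<close>, and to a single coefficient shifted by
  \<open>\<Gamma>\<close>.\<close>

lemma (in module) avoid_subspaces:
  assumes "finite F" "\<And>P. P \<in> F \<Longrightarrow> maximal_ideal P" "subspace X"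
    and "\<And>P. P \<in> F \<Longrightarrow> subspace (W P)"
    and "\<And>P p x. P \<in> F \<Longrightarrow> p \<in> P \<Longrightarrow> x \<in> X \<Longrightarrow> scale p x \<in> W P"
    and "\<And>P. P \<in> F \<Longrightarrow> \<not> X \<subseteq> W P"
  shows "\<exists>x\<in>X. \<forall>P\<in>F. x0 + x \<notin> W P"
  using assms(1,2,4-)
proof (induction F)
  case empty
  show ?case using subspace_0[OF assms(3)] by auto
next
  case (insert Q F)
  then obtain x where x: "x \<in> X" "\<forall>P\<in>F. x0 + x \<notin> W P" by auto
  show ?case
  proof (cases "x0 + x \<in> W Q")
    case True
    have "\<exists>u\<in>P. u \<notin> Q" if "P \<in> F" for P
    proof (rule ccontr)
      assume "\<not> ?thesis"
      then have "Q = P" using that insert.prems(1)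
        by (intro maximal_ideal_subset_eq maximal_imp_prime_ideal) auto
      then show False using that insert.hyps by auto
    qed
    then obtain f where f: "\<And>P. P \<in> F \<Longrightarrow> f P \<in> P \<and> f P \<notin> Q" by metis
    define u where "u = (\<Prod>P\<in>F. f P)"
    have uQ: "u \<notin> Q" unfolding u_def
      using f insert.prems(1) by (intro prime_ideal_prod maximal_imp_prime_ideal) auto
    have uF: "u \<in> P" if "P \<in> F" for P
    proof -
      have "u = (\<Prod>P\<in>F - {P}. f P) * f P"
        unfolding u_def using prod.remove[OF insert.hyps(1) that, of f] by (simp add: mult.commute)
      moreover have "ideal.subspace P" using insert.prems(1) that unfolding maximal_ideal_def by auto
      ultimately show ?thesis using f[OF that] by (simp add: ideal.subspace_scale)
    qed
    obtain y where y: "y \<in> X" "y \<notin> W Q" using insert.prems(4) by blast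
    obtain p r where p: "p \<in> Q" "1 = p + r * u"
      using maximal_ideal_comaximal insert.prems(1) uQ by blast
    \<comment> \<open>\<open>u\<close> is invertible modulo \<open>Q\<close>, and \<open>Q\<close>
      times \<open>X\<close> lies in \<open>W Q\<close>; so \<open>scale u y \<in> W Q\<close> would
      force \<open>y \<in> W Q\<close>.\<close>
    have "y = scale p y + scale r (scale u y)"
      using p(2) by (metis scale_left_distrib scale_one scale_scale)
    then have "scale u y \<notin> W Q"
      using y p(1) insert.prems(2,3) subspace_add subspace_scale by (metis insertI1)
    then have "x0 + x + scale u y \<notin> W Q"
      using True insert.prems(2) subspace_diff[of "W Q" "x0 + x + scale u y" "x0 + x"] by auto
    moreover have "x0 + x + scale u y \<notin> W P" if "P \<in> F" for P
      using x(2) that insert.prems(2,3) uF y(1)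
        subspace_diff[of "W P" "x0 + x + scale u y" "scale u y"] by auto
    moreover have "x + scale u y \<in> X"
      using x(1) y(1) assms(3) by (intro subspace_add subspace_scale)
    ultimately show ?thesis by (intro bexI[of _ "x + scale u y"]) (auto simp: add.assoc)
  qed (use x in auto)
qed

section \<open>Prime divisors of an ideal and the local structure at a prime\<close>

context
  assumes dedekind: "dedekind_domain TYPE('a::idom)"
begin

text \<open>A prime containing \<open>A\<close> contains a factor of any product of nonzero primes
  inside \<open>A\<close>, and equals that factor because nonzero primes are maximal.\<close>

lemma finite_primes_containing:
  assumes "ideal.subspace (A :: 'a set)" "A \<noteq> {0}"
  shows "finite {P. prime_ideal P \<and> A \<subseteq> P}"
proof -
  obtain Qs where Qs: "\<And>Q. Q \<in># Qs \<Longrightarrow> prime_ideal Q \<and> Q \<noteq> {0}" "prod_mset Qs \<subseteq> A"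
    by (rule ideal_contains_prime_product[OF dedekind assms]) blast
  have "{P. prime_ideal P \<and> A \<subseteq> P} \<subseteq> set_mset Qs"
  proof
    fix P assume P: "P \<in> {P. prime_ideal P \<and> A \<subseteq> P}"
    then obtain Q where "Q \<in># Qs" "Q \<subseteq> P" using prod_mset_not_subset_prime Qs(2) by blast
    then show "P \<in># Qs" using Qs(1) P prime_ideal_subset_eq[OF dedekind, of Q P] by auto
  qed
  then show ?thesis by (rule finite_subset) simp
qed

text \<open>Take a product of primes inside \<open>A\<close>. The factors equal to \<open>P\<close>
  are counted by \<open>e\<close>; every other factor has an element outside \<open>P\<close>, and
  these multiply to \<open>s\<close>.\<close>

lemma loc_prime_power_subset:
  assumes "ideal.subspace (A :: 'a set)" "A \<noteq> {0}" "prime_ideal P"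
  obtains e s where "s \<notin> P" "\<And>y. y \<in> P ^ e \<Longrightarrow> s * y \<in> A"
proof -
  obtain Qs where Qs: "\<And>Q. Q \<in># Qs \<Longrightarrow> prime_ideal Q \<and> Q \<noteq> {0}" "prod_mset Qs \<subseteq> A"
    by (rule ideal_contains_prime_product[OF dedekind assms(1,2)]) blast
  have "\<exists>e s. s \<notin> P \<and> (\<forall>y\<in>P ^ e. s * y \<in> prod_mset Qs)"
    using Qs(1)
  proof (induction Qs)
    case empty
    show ?case using prime_idealD(2)[OF assms(3)] by (intro exI[of _ 0] exI[of _ 1]) auto
  next
    case (add Q Qs)
    then obtain e s where es: "s \<notin> P" "\<forall>y\<in>P ^ e. s * y \<in> prod_mset Qs" by auto
    show ?case
    proof (cases "Q = P")
      case True
      have "s * y \<in> prod_mset (add_mset Q Qs)" if y: "y \<in> P ^ Suc e" for y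
      proof -
        obtain p z where pz: "p \<in> P" "z \<in> P ^ e" "y = p * z"
          using y by (auto elim!: set_times_elim)
        have "p * (s * z) \<in> P * prod_mset Qs" using pz(1,2) es(2) by auto
        moreover have "s * y = p * (s * z)" using pz(3) by (simp add: algebra_simps)
        ultimately show ?thesis using True by (simp only: prod_mset.add_mset)
      qed
      then show ?thesis using es(1) by blast
    next
      case False
      then obtain q where q: "q \<in> Q" "q \<notin> P"
        using add.prems[of Q] prime_ideal_subset_eq[OF dedekind, of Q P] assms(3) by auto
      have "q * s * y \<in> prod_mset (add_mset Q Qs)" if "y \<in> P ^ e" for y
        using that q(1) es(2) by (auto simp: mult.assoc)
      then show ?thesis using es(1) q(2) prime_ideal_mult[OF assms(3)] by blast
    qed
  qed
  then show ?thesis using Qs(2) that by blast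
qed

text \<open>If \<open>b / a\<close> maps the nonzero ideal \<open>P\<close> into itself, then it is integral, because
  \<open>a (b / a)\<^sup>n\<close> stays in \<open>P\<close> and \<open>P\<close> is Noetherian.\<close>

lemma quotient_stabilizes_imp_dvd:
  assumes "a \<in> P" "a \<noteq> 0" "\<And>p. p \<in> P \<Longrightarrow> \<exists>w\<in>P. b * p = a * w"
  shows "a dvd (b :: 'a)"
proof -
  have "\<exists>z\<in>P. b ^ n * a = a ^ n * z" for n
  proof (induction n)
    case (Suc n)
    then obtain z where z: "z \<in> P" "b ^ n * a = a ^ n * z" by blast
    then obtain w where w: "w \<in> P" "b * z = a * w" using assms(3) by blast
    have "b ^ Suc n * a = a ^ n * (b * z)" using z(2) by (simp add: algebra_simps)
    then show ?case using w by (intro bexI[of _ w]) (simp_all add: algebra_simps)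
  qed (use assms(1) in auto)
  then obtain z where z: "\<And>n. b ^ n * a = a ^ n * z n" by metis
  define y where "y = to_fract b / to_fract a"
  have yz: "to_fract (z n) = y ^ n * to_fract a" for n
    using arg_cong[OF z[of n], of to_fract] assms(2)
    by (simp add: y_def field_simps to_fract_power)
  \<comment> \<open>\<open>z n\<close> is \<open>y ^ n * to_fract a\<close>, so once the ideals
    generated by initial segments of \<open>z\<close> stabilize, \<open>y ^ N\<close> is a
    combination of lower powers of \<open>y\<close>. This is the monic equation \<open>q\<close> to
    which integral closedness applies.\<close>
  let ?F = "(\<lambda>N. ideal.span (z ` {..<N})) ` UNIV"
  have "?F \<noteq> {}" by auto
  moreover have "ideal.subspace J" if "J \<in> ?F" for J using that by auto
  ultimately obtain M where M: "M \<in> ?F" "\<forall>X\<in>?F. M \<subseteq> X \<longrightarrow> X = M"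
    by (rule ideal_family_maximal[OF dedekind])
  then obtain N where N: "M = ideal.span (z ` {..<N})" by auto
  have "M \<subseteq> ideal.span (z ` {..<Suc N})" unfolding N by (intro ideal.span_mono) auto
  then have "ideal.span (z ` {..<Suc N}) = M" using M(2) by blast
  moreover have "z N \<in> ideal.span (z ` {..<Suc N})" by (intro ideal.span_base) auto
  ultimately have "z N \<in> ideal.span (z ` {..<N})" unfolding N by simp
  then obtain r where r: "z N = (\<Sum>i<N. r i * z i)" by (rule ideal.span_image_sum[OF finite_lessThan])
  have "y ^ N * to_fract a = to_fract (\<Sum>i<N. r i * z i)" using r yz[of N] by simp
  also have "\<dots> = (\<Sum>i<N. to_fract (r i) * y ^ i) * to_fract a"
    by (simp add: yz sum_distrib_right mult.assoc)
  finally have yN: "y ^ N = (\<Sum>i<N. to_fract (r i) * y ^ i)" using assms(2) by simp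
  define q where "q = monom 1 N - (\<Sum>i<N. monom (r i) i)"
  have coeff: "coeff q N = 1" "\<And>i. i > N \<Longrightarrow> coeff q i = 0"
    unfolding q_def by (auto simp: coeff_sum intro!: sum.neutral)
  then have "degree q = N" by (intro antisym degree_le le_degree) auto
  then have "lead_coeff q = 1" using coeff(1) by simp
  moreover have "poly (fract_poly (\<Sum>i\<in>A. monom (r i) i)) y = (\<Sum>i\<in>A. to_fract (r i) * y ^ i)" for A
    by (induction A rule: infinite_finite_induct) (auto simp: map_poly_monom poly_monom)
  then have "poly (fract_poly q) y = 0" unfolding q_def
    using yN by (simp add: map_poly_monom poly_monom)
  ultimately have "y \<in> range to_fract" using dedekind unfolding dedekind_domain_def by blast
  then obtain v where "y = to_fract v" by auto
  then have "to_fract b = to_fract (v * a)" using assms(2) by (simp add: y_def field_simps)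
  then have "b = v * a" by (simp only: to_fract_eq_iff)
  then show ?thesis by simp
qed

text \<open>Take \<open>a \<noteq> 0\<close> in \<open>P\<close> and the least \<open>e\<close> such
  that \<open>P ^ e\<close> lies locally in the ideal of \<open>a\<close>. An element
  \<open>y\<close> of the next lower power gives \<open>b = s * y\<close> which \<open>a\<close>
  does not divide although it divides \<open>b * p\<close> for all \<open>p \<in> P\<close>; the
  fraction \<open>b / a\<close> plays the role of the inverse of a uniformizer.\<close>

lemma uniformizer:
  assumes "prime_ideal (P :: 'a set)" "P \<noteq> {0}"
  obtains t s where "t \<in> P" "t \<noteq> 0" "s \<notin> P" "\<And>x. x \<in> P \<Longrightarrow> t dvd s * x"
proof -
  have P: "ideal.subspace P" by (rule prime_idealD(1)[OF assms(1)])
  obtain a where a: "a \<in> P" "a \<noteq> 0" using assms(2) ideal.subspace_0[OF P] by auto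
  have "{x. a dvd x} \<noteq> {0}" using a(2) by (metis dvd_refl mem_Collect_eq singletonD)
  then obtain e0 s0 where "s0 \<notin> P" "\<And>y. y \<in> P ^ e0 \<Longrightarrow> s0 * y \<in> {x. a dvd x}"
    using loc_prime_power_subset[OF subspace_principal _ assms(1)] by metis
  then have "\<exists>e. \<exists>s. s \<notin> P \<and> (\<forall>y\<in>P ^ e. a dvd s * y)" by auto
  then obtain e s where e: "s \<notin> P" "\<forall>y\<in>P ^ e. a dvd s * y"
    and least: "\<And>n s. n < e \<Longrightarrow> s \<notin> P \<Longrightarrow> \<exists>y\<in>P ^ n. \<not> a dvd s * y"
    using exists_least_iff[of "\<lambda>e. \<exists>s. s \<notin> P \<and> (\<forall>y\<in>P ^ e. a dvd s * y)"] by metis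
  have "e \<noteq> 0"
  proof
    assume "e = 0"
    then have "a dvd s" using e(2) by simp
    then obtain v where "s = v * a" by (metis dvdE mult.commute)
    then show False using e(1) ideal.subspace_scale[OF P a(1)] by simp
  qed
  then obtain n where n: "e = Suc n" by (cases e) auto
  then obtain y where y: "y \<in> P ^ n" "\<not> a dvd s * y" using least[of n s] e(1) by auto
  define b where "b = s * y"
  have b: "a dvd b * p" if "p \<in> P" for p
  proof -
    have "p * y \<in> P ^ e" using that y(1) n by auto
    then show ?thesis using e(2) by (auto simp: b_def ac_simps)
  qed
  \<comment> \<open>Were \<open>b / a\<close> to map \<open>P\<close> into itself,
    \<open>a dvd b\<close> would follow. So it maps some \<open>t \<in> P\<close> to an element
    \<open>w \<notin> P\<close>, and this \<open>t\<close> generates \<open>P\<close>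
    locally.\<close>
  obtain t w where tw: "t \<in> P" "w \<notin> P" "b * t = a * w"
    using quotient_stabilizes_imp_dvd[OF a, of b] b y(2) unfolding b_def dvd_def by blast
  have "t dvd w * x" if "x \<in> P" for x
  proof -
    have "a dvd b * x" by (rule b[OF that])
    then obtain v where v: "b * x = a * v" ..
    have "a * (w * x) = t * (b * x)" using tw(3) by (simp add: algebra_simps)
    also have "\<dots> = a * (t * v)" using v by (simp add: algebra_simps)
    finally show ?thesis using a(2) by simp
  qed
  moreover have "t \<noteq> 0"
    using tw a(2) ideal.subspace_0[OF P] by auto
  ultimately show ?thesis using that tw by blast
qed

text \<open>The local ring at \<open>P\<close> is a discrete valuation ring, stated without leaving \<open>'a\<close>.\<close>

lemma dvr:
  assumes "prime_ideal (P :: 'a set)" "P \<noteq> {0}" "x \<noteq> 0"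
  obtains e s where "s \<notin> P" "x \<in> ideal_power P e" "x \<notin> ideal_power P (Suc e)"
    "\<And>y. y \<in> ideal_power P e \<Longrightarrow> x dvd s * y"
proof -
  have P: "ideal.subspace P" by (rule prime_idealD(1)[OF assms(1)])
  have max: "maximal_ideal P" by (rule nonzero_prime_maximal[OF dedekind assms(1,2)])
  obtain t s where t: "t \<in> P" "t \<noteq> 0" "s \<notin> P" "\<And>x. x \<in> P \<Longrightarrow> t dvd s * x"
    by (rule uniformizer[OF assms(1,2)]) blast
  have tP: "t * z \<in> P" for z using ideal.subspace_scale[OF P t(1), of z] by (simp add: mult.commute)
  have "{y. x dvd y} \<noteq> {0}" using assms(3) by (metis dvd_refl mem_Collect_eq singletonD)
  then obtain e0 s0 where s0: "s0 \<notin> P" "\<And>y. y \<in> P ^ e0 \<Longrightarrow> s0 * y \<in> {y. x dvd y}"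
    using loc_prime_power_subset[OF subspace_principal _ assms(1)] by metis
  have "x dvd s0 * t ^ e0" using s0(2) power_mem_set_power[OF t(1)] by auto
  \<comment> \<open>Descent on the exponent: if the cofactor of \<open>x\<close> lies in
    \<open>P\<close>, then \<open>t\<close> divides it up to \<open>s\<close> and one factor
    \<open>t\<close> cancels; otherwise \<open>x\<close> is \<open>t ^ e\<close> up to local
    units.\<close>
  then have "\<exists>e w w'. w \<notin> P \<and> w' \<notin> P \<and> w * x = w' * t ^ e"
    using s0(1)
  proof (induction e0 arbitrary: s0)
    case 0
    then obtain w where w: "s0 = x * w" by auto
    then have "w \<notin> P" using 0(2) ideal.subspace_scale[OF P, of w x] by auto
    then show ?case using w 0(2) by (intro exI[of _ 0] exI[of _ w] exI[of _ s0]) (simp add: ac_simps)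
  next
    case (Suc n)
    then obtain w where w: "s0 * t ^ Suc n = x * w" by auto
    show ?case
    proof (cases "w \<in> P")
      case False
      then show ?thesis using w Suc.prems(2)
        by (intro exI[of _ "Suc n"] exI[of _ w] exI[of _ s0]) (simp add: ac_simps)
    next
      case True
      then obtain v where v: "s * w = t * v" using t(4) by (auto elim!: dvdE)
      have "t * ((s * s0) * t ^ n) = x * (s * w)" using w by (simp add: algebra_simps)
      also have "\<dots> = t * (x * v)" using v by (simp add: algebra_simps)
      finally have "x dvd (s * s0) * t ^ n" using t(2) by simp
      then show ?thesis using Suc.IH prime_ideal_mult[OF assms(1) t(3) Suc.prems(2)] by blast
    qed
  qed
  then obtain e w w' where w: "w \<notin> P" "w' \<notin> P" "w * x = w' * t ^ e" by blast
  have dvd: "t ^ n dvd s ^ n * y" if "y \<in> ideal_power P n" for n y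
  proof -
    have "t ^ n dvd s ^ n * y" if "y \<in> P ^ n" for y
      using that
    proof (induction n arbitrary: y)
      case (Suc n)
      then obtain p z where "p \<in> P" "z \<in> P ^ n" "y = p * z" by (auto elim!: set_times_elim)
      then have "t * t ^ n dvd (s * p) * (s ^ n * z)" using t(4) Suc.IH by (intro mult_dvd_mono) auto
      then show ?case using \<open>y = p * z\<close> by (simp add: ac_simps)
    qed simp
    moreover have "ideal.subspace {y. t ^ n dvd s ^ n * y}"
      by (rule ideal.subspaceI) (auto simp: distrib_left mult.left_commute)
    ultimately have "ideal.span (P ^ n) \<subseteq> {y. t ^ n dvd s ^ n * y}"
      by (intro ideal.span_minimal) auto
    then show ?thesis using that unfolding ideal_power_def by auto
  qed
  have "w' * t ^ e \<in> ideal_power P e"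
    unfolding ideal_power_def by (intro ideal.span_scale ideal.span_base power_mem_set_power t(1))
  then have "x \<in> ideal_power P e" using maximal_ideal_power_cancel[OF max w(1)] w(3) by simp
  \<comment> \<open>One more factor \<open>t\<close> in \<open>x\<close> would make \<open>t\<close>
    divide \<open>s ^ Suc e * w'\<close>, a product of elements outside \<open>P\<close>.\<close>
  moreover have "x \<notin> ideal_power P (Suc e)"
  proof
    assume "x \<in> ideal_power P (Suc e)"
    then have "t ^ Suc e dvd w * (s ^ Suc e * x)" by (rule dvd_mult[OF dvd])
    also have "w * (s ^ Suc e * x) = (s ^ Suc e * w') * t ^ e" using w(3) by (simp add: algebra_simps)
    finally obtain z where "s ^ Suc e * w' = t * z" using t(2) by (auto elim!: dvdE)
    then have "s ^ Suc e * w' \<in> P" using tP by simp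
    then show False
      using prime_ideal_mult[OF assms(1) prime_ideal_power[OF assms(1) t(3)] w(2)] by blast
  qed
  moreover have "x dvd (w' * s ^ e) * y" if "y \<in> ideal_power P e" for y
  proof -
    have "t ^ e dvd s ^ e * y" by (rule dvd[OF that])
    then obtain z where "s ^ e * y = t ^ e * z" ..
    then have "(w' * s ^ e) * y = (w' * t ^ e) * z" by (simp add: ac_simps)
    also have "\<dots> = x * (w * z)" unfolding w(3)[symmetric] by (simp add: ac_simps)
    finally show ?thesis by simp
  qed
  moreover have "w' * s ^ e \<notin> P"
    using prime_ideal_mult[OF assms(1) w(2) prime_ideal_power[OF assms(1) t(3)]] .
  ultimately show ?thesis using that by blast
qed

text \<open>An element \<open>c\<close> of \<open>A\<close> of least valuation generates: by
  \<open>dvr\<close>, one multiplier \<open>s\<close> makes it divide all elements of at least that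
  valuation. At \<open>P = {0}\<close> any nonzero \<open>c\<close> works, with \<open>c\<close>
  itself as multiplier.\<close>

lemma locally_principal:
  assumes "ideal.subspace (A :: 'a set)" "A \<noteq> {0}" "prime_ideal P"
  obtains c s where "c \<in> A" "c \<noteq> 0" "s \<notin> P" "\<And>x. x \<in> A \<Longrightarrow> c dvd s * x"
proof (cases "P = {0}")
  case True
  obtain c where "c \<in> A" "c \<noteq> 0" using assms(1,2) ideal.subspace_0 by blast
  then show ?thesis using that[of c c] True by auto
next
  case False
  let ?v = "\<lambda>e. \<exists>x\<in>A. x \<noteq> 0 \<and> x \<in> ideal_power P e \<and> x \<notin> ideal_power P (Suc e)"
  obtain c0 where "c0 \<in> A" "c0 \<noteq> 0" using assms(1,2) ideal.subspace_0 by blast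
  then have "\<exists>e. ?v e" using dvr[OF assms(3) False, of c0] by metis
  then obtain e where e: "?v e" "\<And>n. n < e \<Longrightarrow> \<not> ?v n"
    using exists_least_iff[of ?v] by metis
  then obtain c where c: "c \<in> A" "c \<noteq> 0" "c \<in> ideal_power P e" "c \<notin> ideal_power P (Suc e)"
    by blast
  obtain e' s where s: "s \<notin> P" "c \<in> ideal_power P e'" "c \<notin> ideal_power P (Suc e')"
    "\<And>y. y \<in> ideal_power P e' \<Longrightarrow> c dvd s * y"
    by (rule dvr[OF assms(3) False c(2)]) blast
  have "e' = e" using ideal_valuation_eq[OF c(3,4)] ideal_valuation_eq[OF s(2,3)] by simp
  have "c dvd s * x" if "x \<in> A" for x
  proof (cases "x = 0")
    case False
    obtain n where n: "x \<in> ideal_power P n" "x \<notin> ideal_power P (Suc n)"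
      using dvr[OF assms(3) \<open>P \<noteq> {0}\<close> False] by metis
    then have "\<not> n < e" using e(2) False that by blast
    then have "x \<in> ideal_power P e" using n(1) ideal_power_antimono[of e n P] by auto
    then show ?thesis using s(4) \<open>e' = e\<close> by simp
  qed simp
  then show ?thesis using that c s(1) by blast
qed

text \<open>In a discrete valuation ring minimal valuation means divisibility. Nonvanishing holds
  because the infinite set \<open>T\<close> has a point off the earlier ones, so the minimum is
  finite.\<close>

lemma P_ordering_dvd:
  assumes "prime_ideal (P :: 'a set)" "P \<noteq> {0}" "P_ordering P T c" "infinite T"
  shows "(\<Prod>i<r. c r - c i) \<noteq> 0"
    and "\<exists>s. s \<notin> P \<and> (\<forall>x\<in>T. (\<Prod>i<r. c r - c i) dvd s * (\<Prod>i<r. x - c i))"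
proof -
  let ?D = "\<Prod>i<r. c r - c i"
  have le: "ideal_valuation P ?D \<le> ideal_valuation P (\<Prod>i<r. x - c i)" if "x \<in> T" for x
  proof (cases "r \<ge> 1")
    case True
    then show ?thesis using assms(3) that unfolding P_ordering_def by blast
  next
    \<comment> \<open>\<open>P_ordering\<close> imposes minimality only from \<open>r = 1\<close>
      on; at \<open>r = 0\<close> both products are empty.\<close>
    case False
    then have "r = 0" by simp
    then show ?thesis by simp
  qed
  have val: "\<exists>k. ideal_valuation P x = enat k \<and> x \<in> ideal_power P k" if "x \<noteq> 0" for x
    using dvr[OF assms(1,2) that] ideal_valuation_eq by metis
  have "infinite (T - c ` {..<r})" using assms(4) by (intro Diff_infinite_finite) auto
  then obtain x where "x \<in> T - c ` {..<r}" using infinite_imp_nonempty by blast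
  then have "x \<in> T" "(\<Prod>i<r. x - c i) \<noteq> 0" by auto
  then obtain k where "ideal_valuation P ?D \<le> enat k" using le[of x] val by metis
  then show D0: "?D \<noteq> 0" using ideal_valuation_zero[of P] by (metis enat_ord_simps(5) enat.distinct(1))
  obtain e s where s: "s \<notin> P" "?D \<in> ideal_power P e" "?D \<notin> ideal_power P (Suc e)"
    "\<And>y. y \<in> ideal_power P e \<Longrightarrow> ?D dvd s * y"
    by (rule dvr[OF assms(1,2) D0]) blast
  have "?D dvd s * (\<Prod>i<r. x - c i)" if "x \<in> T" for x
  proof (cases "(\<Prod>i<r. x - c i) = 0")
    case False
    then obtain k where k: "ideal_valuation P (\<Prod>i<r. x - c i) = enat k"
      "(\<Prod>i<r. x - c i) \<in> ideal_power P k" using val by blast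
    then have "e \<le> k" using le[OF that] ideal_valuation_eq[OF s(2,3)] by simp
    then show ?thesis using s(4) k(2) ideal_power_antimono[of e k P] by blast
  qed (metis dvd_0_right mult_zero_right)
  then show "\<exists>s. s \<notin> P \<and> (\<forall>x\<in>T. ?D dvd s * (\<Prod>i<r. x - c i))" using s(1) by blast
qed

text \<open>Where \<open>G\<close> is not inside \<open>P\<close>, both sides are locally the unit
  ideal. For the finitely many other primes, \<open>c \<in> J\<close> is chosen outside every
  \<open>P J\<close>, and such an element generates \<open>J\<close> locally.\<close>

lemma ideal_eq_span_insert:
  assumes "ideal.subspace (G :: 'a set)" "ideal.subspace J" "G \<subseteq> J" "G \<noteq> {0}"
  obtains c where "c \<in> J" "J = ideal.span (insert c G)"
proof -
  have J0: "J \<noteq> {0}" using assms ideal.subspace_0 by fastforce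
  let ?F = "{P. prime_ideal P \<and> G \<subseteq> P}"
  let ?W = "\<lambda>P. ideal.span (P * J)"
  have F: "maximal_ideal P" if "P \<in> ?F" for P
    using that assms(1,4) ideal.subspace_0 by (intro nonzero_prime_maximal[OF dedekind]) fastforce+
  \<comment> \<open>Locally \<open>J\<close> consists of multiples of \<open>c\<close>, and
    \<open>P J\<close> of multiples with cofactor in \<open>P\<close>. Hence \<open>c\<close> is not
    in \<open>P J\<close>, as \<open>s * c = p * c\<close> would give \<open>s \<in> P\<close>; this
    supplies the noncontainment needed for avoidance.\<close>
  have gen: "\<exists>c s. c \<in> J \<and> c \<noteq> 0 \<and> s \<notin> P \<and> (\<forall>x\<in>J. c dvd s * x) \<and>
      (\<forall>x\<in>?W P. \<exists>p\<in>P. s * x = p * c)" if P': "prime_ideal P" for P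
  proof -
    obtain c s where c: "c \<in> J" "c \<noteq> 0" "s \<notin> P" "\<And>x. x \<in> J \<Longrightarrow> c dvd s * x"
      by (rule locally_principal[OF assms(2) J0 P']) blast
    have P: "ideal.subspace P" by (rule prime_idealD(1)[OF P'])
    have "ideal.subspace {x. \<exists>p\<in>P. s * x = p * c}"
    proof (rule ideal.subspaceI; clarsimp)
      show "\<exists>p\<in>P. p = 0 \<or> c = 0" using ideal.subspace_0[OF P] by auto
    next
      fix x y p q assume "s * x = p * c" "s * y = q * c" "p \<in> P" "q \<in> P"
      then show "\<exists>r\<in>P. s * (x + y) = r * c"
        using ideal.subspace_add[OF P] by (intro bexI[of _ "p + q"]) (auto simp: algebra_simps)
    next
      fix r x p assume "s * x = p * c" "p \<in> P"
      then show "\<exists>p\<in>P. s * (r * x) = p * c"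
        using ideal.subspace_scale[OF P] by (intro bexI[of _ "r * p"]) (auto simp: algebra_simps)
    qed
    moreover have "P * J \<subseteq> {x. \<exists>p\<in>P. s * x = p * c}"
    proof
      fix x assume "x \<in> P * J"
      then obtain p j where pj: "p \<in> P" "j \<in> J" "x = p * j" by (auto elim!: set_times_elim)
      obtain v where "s * j = c * v" using c(4)[OF pj(2)] by auto
      then have "s * x = (v * p) * c" using pj(3) by (simp add: algebra_simps)
      then show "x \<in> {x. \<exists>p\<in>P. s * x = p * c}" using ideal.subspace_scale[OF P pj(1)] by auto
    qed
    ultimately show ?thesis using ideal.span_minimal c by blast
  qed
  have "\<exists>c\<in>J. \<forall>P\<in>?F. 0 + c \<notin> ?W P"
  proof (rule ideal.avoid_subspaces)
    show "finite ?F" by (rule finite_primes_containing[OF assms(1,4)])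
    show "\<not> J \<subseteq> ?W P" if "P \<in> ?F" for P
      using gen[of P] that by force
  qed (use F assms(2) in \<open>auto intro: ideal.span_base\<close>)
  then obtain c where c: "c \<in> J" "\<And>P. P \<in> ?F \<Longrightarrow> c \<notin> ?W P" by auto
  let ?A = "ideal.span (insert c G)"
  have "J \<subseteq> ?A"
  proof
    fix x assume x: "x \<in> J"
    show "x \<in> ?A"
    proof (rule mem_ideal_local[OF dedekind ideal.subspace_span])
      fix P :: "'a set" assume P: "prime_ideal P"
      show "x \<in> loc P ?A"
      proof (cases "G \<subseteq> P")
        case False
        then obtain s where "s \<in> G" "s \<notin> P" by auto
        moreover then have "x * s \<in> ?A" by (intro ideal.span_scale ideal.span_base) auto
        ultimately show ?thesis by (intro locI[of s]) (simp_all add: mult.commute)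
      next
        case True
        obtain d s where d: "d \<in> J" "d \<noteq> 0" "s \<notin> P" "\<forall>x\<in>J. d dvd s * x"
          using gen[OF P] by blast
        obtain z where z: "s * c = d * z" using d(4) c(1) by blast
        \<comment> \<open>\<open>z\<close> is the coordinate of \<open>c\<close> along the local
          generator \<open>d\<close>. If it were in \<open>P\<close>, then \<open>s * c\<close>, and
          by comaximality of \<open>s\<close> and \<open>P\<close> also \<open>c\<close>, would lie
          in \<open>P J\<close>.\<close>
        have "z \<notin> P"
        proof
          assume "z \<in> P"
          then have "s * c \<in> ?W P" unfolding z using d(1)
            by (intro ideal.span_base) (auto simp: mult.commute[of d])
          moreover obtain p r where pr: "p \<in> P" "1 = p + r * s"
            using maximal_ideal_comaximal F True P d(3) by blast
          have "p * c \<in> ?W P" using pr(1) c(1) by (intro ideal.span_base) auto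
          moreover have "c = (p + r * s) * c" using pr(2) by simp
          then have "c = p * c + r * (s * c)" by (simp add: algebra_simps)
          ultimately have "c \<in> ?W P" using ideal.span_add ideal.span_scale by metis
          then show False using c(2) True P by blast
        qed
        obtain v where v: "s * x = d * v" using d(4) x by blast
        have "(s * z) * x = v * (d * z)" using v by (simp add: algebra_simps)
        also have "\<dots> = (v * s) * c" unfolding z[symmetric] by (simp add: ac_simps)
        also have "\<dots> \<in> ?A" by (intro ideal.span_scale ideal.span_base) auto
        finally show ?thesis using prime_ideal_mult[OF P d(3) \<open>z \<notin> P\<close>] by (intro locI)
      qed
    qed
  qed
  moreover have "?A \<subseteq> J" using assms(2,3) c(1) by (intro ideal.span_minimal) auto
  ultimately show ?thesis using that c(1) by blast
qed

end

section \<open>Polynomials in several variables\<close>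

abbreviation lookup :: "('b \<Rightarrow>\<^sub>0 'c::zero) \<Rightarrow> 'b \<Rightarrow> 'c" where "lookup \<equiv> Poly_Mapping.lookup"
abbreviation keys :: "('b \<Rightarrow>\<^sub>0 'c::zero) \<Rightarrow> 'b set" where "keys \<equiv> Poly_Mapping.keys"
abbreviation single :: "'b \<Rightarrow> 'c \<Rightarrow> ('b \<Rightarrow>\<^sub>0 'c::zero)" where "single \<equiv> Poly_Mapping.single"
abbreviation supp :: "('n, 'a::zero) mpoly \<Rightarrow> ('n \<Rightarrow> nat) set" where "supp f \<equiv> lookup ` keys f"
abbreviation fmap :: "('n, 'a::idom) mpoly \<Rightarrow> ('n, 'a fract) mpoly" where
  "fmap \<equiv> Poly_Mapping.map to_fract"

lemma mpoly_induct [case_names single add]: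
  fixes f :: "('n, 'a::comm_monoid_add) mpoly"
  assumes "\<And>\<alpha> c. Q (single \<alpha> c)" "\<And>f g. Q f \<Longrightarrow> Q g \<Longrightarrow> Q (f + g)"
  shows "Q f"
proof -
  have f: "f = (\<Sum>\<alpha>\<in>keys f. single \<alpha> (lookup f \<alpha>))"
    by (rule poly_mapping_eqI)
      (simp add: lookup_sum lookup_single when_def in_keys_iff)
  have "Q (\<Sum>\<alpha>\<in>A. single \<alpha> (lookup f \<alpha>))" if "finite A" for A
    using that assms(1)[of 0 0] by (induction A) (auto intro: assms)
  then show ?thesis by (subst f) simp
qed

lemma Const_mult_single: "Const c * single \<alpha> d = single \<alpha> (c * d :: 'a::comm_semiring_1)"
  unfolding Const_def by (simp add: mult_single)

lemma lookup_Const_mult: "lookup (Const c * f) \<alpha> = c * lookup f \<alpha>"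
  for f :: "('n, 'a::comm_semiring_1) mpoly"
  by (induction f rule: mpoly_induct)
    (auto simp: Const_mult_single lookup_single when_def distrib_left lookup_add)

lemma Const_add: "Const (c + d) = Const c + Const (d :: 'a::comm_monoid_add)"
  unfolding Const_def by (rule single_add)

lemma Const_mult: "Const (c * d) = Const c * Const (d :: 'a::comm_semiring_1)"
  unfolding Const_def by (simp add: mult_single)

lemma Const_zero [simp]: "Const 0 = 0"
  unfolding Const_def by simp

lemma Const_one [simp]: "Const 1 = 1"
  unfolding Const_def by simp

lemma lookup_Const: "lookup (Const c) \<alpha> = (if \<alpha> = 0 then c else 0)"
  unfolding Const_def by (simp add: lookup_single when_def)

global_interpretation mpoly: module "\<lambda>(c :: 'a::comm_ring_1) (f :: ('n, 'a) mpoly). Const c * f"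
  by unfold_locales (simp_all add: algebra_simps Const_add Const_mult)

subsection \<open>Evaluation and change of coefficients\<close>

lemma eval_superset:
  assumes "finite A" "keys f \<subseteq> A"
  shows "eval s f = (\<Sum>\<alpha>\<in>A. lookup f \<alpha> * (\<Prod>j\<in>UNIV. s j ^ lookup \<alpha> j))"
  unfolding eval_def using assms by (intro sum.mono_neutral_left) (auto simp: in_keys_iff)

lemma eval_add [simp]: "eval s (f + g) = eval s f + eval s g"
proof -
  let ?A = "keys f \<union> keys g"
  have "eval s (f + g) = (\<Sum>\<alpha>\<in>?A. lookup (f + g) \<alpha> * (\<Prod>j\<in>UNIV. s j ^ lookup \<alpha> j))"
    by (rule eval_superset) (use Poly_Mapping.keys_add[of f g] in auto)
  also have "\<dots> = eval s f + eval s g"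
    by (simp add: lookup_add distrib_right sum.distrib eval_superset[of ?A])
  finally show ?thesis .
qed

lemma eval_single: "eval s (single \<alpha> c) = c * (\<Prod>j\<in>UNIV. s j ^ lookup \<alpha> j)"
  by (subst eval_superset[of "{\<alpha>}"]) auto

lemma eval_mult [simp]: "eval s (f * g) = eval s f * eval s g"
proof (induction f rule: mpoly_induct)
  case (single \<alpha> c)
  show ?case
  proof (induction g rule: mpoly_induct)
    case (single \<beta> d)
    show ?case by (simp add: mult_single eval_single lookup_add power_add prod.distrib ac_simps)
  qed (simp only: distrib_left eval_add)
qed (simp only: distrib_right eval_add)

lemma eval_Const [simp]: "eval s (Const c) = c"
  unfolding Const_def by (simp add: eval_single)

lemma eval_one [simp]: "eval s 1 = 1"
  using eval_Const[of s 1] by simp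

lemma eval_zero [simp]: "eval s 0 = 0"
  using eval_Const[of s 0] by simp

lemma eval_Var [simp]: "eval s (Var j) = s j"
proof -
  have "(\<Prod>l\<in>UNIV. s l ^ lookup (single j (1::nat)) l) = (\<Prod>l\<in>UNIV. if l = j then s l else 1)"
    by (intro prod.cong) (auto simp: lookup_single when_def)
  then show ?thesis unfolding Var_def by (simp add: eval_single)
qed

lemma eval_sum [simp]: "eval s (\<Sum>i\<in>A. f i) = (\<Sum>i\<in>A. eval s (f i))"
  by (induction A rule: infinite_finite_induct) auto

lemma eval_prod [simp]: "eval s (\<Prod>i\<in>A. f i) = (\<Prod>i\<in>A. eval s (f i))"
  by (induction A rule: infinite_finite_induct) auto

lemma eval_diff [simp]: "eval s (f - g) = eval s f - eval s (g :: ('n::finite, 'a::comm_ring_1) mpoly)"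
  using eval_add[of s "f - g" g] by (simp add: algebra_simps)

lemma lookup_fmap [simp]: "lookup (fmap f) \<alpha> = to_fract (lookup f \<alpha>)"
  by (simp add: Poly_Mapping.map.rep_eq when_def)

lemma keys_fmap [simp]: "keys (fmap f) = keys f"
  by (auto simp: in_keys_iff)

lemma fmap_add: "fmap (f + g) = fmap f + fmap g"
  by (rule poly_mapping_eqI) (simp add: lookup_add)

lemma fmap_diff: "fmap (f - g) = fmap f - fmap g"
  by (rule poly_mapping_eqI) (simp add: lookup_minus)

lemma fmap_mult: "fmap (f * g) = fmap f * fmap g"
proof (induction f rule: mpoly_induct)
  case (single \<alpha> c)
  show ?case
    by (induction g rule: mpoly_induct) (auto simp: mult_single fmap_add distrib_left)
qed (auto simp: fmap_add distrib_right)

lemma fmap_Const: "fmap (Const c) = Const (to_fract c)"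
  unfolding Const_def by simp

lemma fmap_prod: "fmap (\<Prod>i\<in>A. f i) = (\<Prod>i\<in>A. fmap (f i))"
  using fmap_Const[of 1]
  by (induction A rule: infinite_finite_induct) (auto simp: fmap_mult)

lemma fmap_eq_zero_iff [simp]: "fmap f = 0 \<longleftrightarrow> f = 0"
  by (auto simp: poly_mapping_eq_iff fun_eq_iff)

lemma to_fract_prod: "to_fract (prod g A) = (\<Prod>i\<in>A. to_fract (g i))"
  by (induction A rule: infinite_finite_induct) auto

lemma eval_fmap [simp]: "eval (\<lambda>j. to_fract (s j)) (fmap f) = to_fract (eval s f)"
  unfolding eval_def by (simp add: to_fract_power to_fract_prod)

lemma integral_mpolys_iff: "g \<in> integral_mpolys \<longleftrightarrow> g \<in> range fmap"
proof
  assume "g \<in> integral_mpolys"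
  then have "\<forall>\<alpha>. \<exists>c. lookup g \<alpha> = to_fract c" unfolding integral_mpolys_def by auto
  then obtain h where h: "\<And>\<alpha>. lookup g \<alpha> = to_fract (h \<alpha>)" by metis
  have "g = fmap (\<Sum>\<alpha>\<in>keys g. single \<alpha> (h \<alpha>))"
    by (rule poly_mapping_eqI) (use h in \<open>auto simp: lookup_sum lookup_single when_def in_keys_iff\<close>)
  then show "g \<in> range fmap" by blast
qed (auto simp: integral_mpolys_def)

subsection \<open>Supports and degrees\<close>

lemma mdeg_tdeg_le_iff: "mdeg g \<le> m \<and> tdeg g \<le> k \<longleftrightarrow> supp g \<subseteq> multi_indices m k"
  unfolding mdeg_def tdeg_def multi_indices_def le_fun_def by (auto simp: image_subset_iff)

lemma multi_indices_down: "i \<in> multi_indices m k \<Longrightarrow> l \<le> i \<Longrightarrow> l \<in> multi_indices m k"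
  unfolding multi_indices_def using order_trans sum_mono[of UNIV l i]
  by (auto simp: le_fun_def intro: order_trans)

lemma finite_atMost_fun: "finite {..m :: 'n::finite \<Rightarrow> nat}"
proof -
  have "{..m} = Pi\<^sub>E UNIV (\<lambda>j. {..m j})"
    by (auto simp: le_fun_def PiE_def extensional_def Pi_iff)
  then show ?thesis by (simp add: finite_PiE)
qed

lemma finite_multi_indices: "finite (multi_indices m k)"
  by (rule finite_subset[OF _ finite_atMost_fun[of m]]) (auto simp: multi_indices_def)

lemma multi_indices_self: "multi_indices i (\<Sum>j\<in>UNIV. i j) = {..i}"
  unfolding multi_indices_def by (auto simp: le_fun_def intro: sum_mono)

lemma obtain_exponent:
  fixes i :: "'n::finite \<Rightarrow> nat"
  obtains \<alpha> where "lookup \<alpha> = i"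
proof
  show "lookup (Abs_poly_mapping i) = i" by simp
qed

text \<open>The disjuncts for \<open>0\<close> come from the \<open>0\<close> inserted into the
  maxima of \<open>mdeg\<close> and \<open>tdeg\<close>; every positive degree must be attained by
  an exponent.\<close>

lemma of_type_iff:
  fixes f :: "('n::finite, 'a::zero) mpoly"
  shows "of_type f m k \<longleftrightarrow> supp f \<subseteq> multi_indices m k \<and>
    (\<forall>j. m j = 0 \<or> (\<exists>i\<in>supp f. i j = m j)) \<and> (k = 0 \<or> (\<exists>i\<in>supp f. (\<Sum>j\<in>UNIV. i j) = k))"
proof -
  have *: "Max (insert 0 A) = n \<longleftrightarrow> (\<forall>a\<in>A. a \<le> n) \<and> (n = 0 \<or> n \<in> A)" if "finite A" for A and n :: nat
    using that by (auto simp: Max_eq_iff)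
  have "mdeg f = m \<longleftrightarrow> (\<forall>j. (\<forall>i\<in>supp f. i j \<le> m j) \<and> (m j = 0 \<or> (\<exists>i\<in>supp f. i j = m j)))"
    unfolding mdeg_def fun_eq_iff by (intro iff_allI, subst *) (auto, metis imageI)
  moreover have "tdeg f = k \<longleftrightarrow> (\<forall>i\<in>supp f. (\<Sum>j\<in>UNIV. i j) \<le> k) \<and>
      (k = 0 \<or> (\<exists>i\<in>supp f. (\<Sum>j\<in>UNIV. i j) = k))"
    unfolding tdeg_def by (subst *) auto
  ultimately show ?thesis unfolding of_type_def multi_indices_def by (auto simp: le_fun_def)
qed

lemma exists_index_sum:
  fixes m :: "'n::finite \<Rightarrow> nat"
  assumes "k \<le> (\<Sum>j\<in>UNIV. m j)"
  obtains i where "i \<le> m" "(\<Sum>j\<in>UNIV. i j) = k"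
proof -
  have "\<exists>i\<le>m. (\<Sum>j\<in>UNIV. i j) = k" using assms
  proof (induction k)
    case 0
    show ?case by (intro exI[of _ "\<lambda>_. 0"]) (simp add: le_fun_def)
  next
    case (Suc k)
    then obtain i where i: "i \<le> m" "(\<Sum>j\<in>UNIV. i j) = k" by auto
    have "\<exists>j. i j < m j"
    proof (rule ccontr)
      assume "\<not> ?thesis"
      then have "(\<Sum>j\<in>UNIV. m j) \<le> (\<Sum>j\<in>UNIV. i j)" by (intro sum_mono) (simp add: not_less)
      then show False using Suc.prems i(2) by simp
    qed
    then obtain j where j: "i j < m j" by blast
    have "(\<Sum>l\<in>UNIV. (i(j := Suc (i j))) l) = Suc (i j) + (\<Sum>l\<in>UNIV - {j}. i l)"
      by (subst sum.remove[of _ j]) (auto intro!: sum.cong)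
    also have "\<dots> = Suc (\<Sum>l\<in>UNIV. i l)" by (subst sum.remove[of UNIV j i]) auto
    finally show ?case using i j by (intro exI[of _ "i(j := Suc (i j))"]) (auto simp: le_fun_def)
  qed
  then show ?thesis using that by blast
qed

text \<open>The partial degree \<open>m j\<close> is attained by a pure power, which is available
  because \<open>m j \<le> k\<close>; the total degree \<open>k\<close> is attained because
  \<open>k\<close> does not exceed the sum of \<open>m\<close>.\<close>

lemma of_type_full_support:
  fixes f :: "('n::finite, 'a::zero) mpoly"
  assumes "supp f = multi_indices m k" "Max (range m) \<le> k" "k \<le> (\<Sum>j\<in>UNIV. m j)"
  shows "of_type f m k"
proof -
  have "\<exists>i\<in>multi_indices m k. i j = m j" for j
  proof (intro bexI[of _ "\<lambda>l. if l = j then m j else 0"])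
    have "m j \<le> Max (range m)" by (intro Max_ge) auto
    then show "(\<lambda>l. if l = j then m j else 0) \<in> multi_indices m k"
      using assms(2) unfolding multi_indices_def by (auto simp: le_fun_def)
  qed simp
  moreover obtain i where "i \<le> m" "(\<Sum>j\<in>UNIV. i j) = k" using exists_index_sum[OF assms(3)] .
  then have "\<exists>i\<in>multi_indices m k. (\<Sum>j\<in>UNIV. i j) = k" unfolding multi_indices_def by auto
  ultimately show ?thesis unfolding of_type_iff assms(1) by blast
qed

subsection \<open>The basis polynomials\<close>

text \<open>The exponent dominates all others componentwise, not just in some monomial order. This
  yields at once the degree bound and a coefficient \<open>1\<close> for basis polynomials.\<close>

definition monic_at :: "('n, 'a::comm_ring_1) mpoly \<Rightarrow> ('n \<Rightarrow>\<^sub>0 nat) \<Rightarrow> bool" where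
  "monic_at f \<alpha> \<longleftrightarrow> lookup f \<alpha> = 1 \<and> (\<forall>\<gamma>\<in>keys f. lookup \<gamma> \<le> lookup \<alpha>)"

text \<open>Only the two top monomials contribute at \<open>\<alpha> + \<beta>\<close>: exponents
  \<open>a\<close>, \<open>b\<close> bounded by \<open>\<alpha>\<close>, \<open>\<beta>\<close> with
  the same sum must be equal to them.\<close>

lemma monic_at_mult:
  assumes "monic_at f \<alpha>" "monic_at g \<beta>"
  shows "monic_at (f * g) (\<alpha> + \<beta>)"
proof -
  have le: "lookup \<gamma> \<le> lookup (\<alpha> + \<beta>)" if \<gamma>: "\<gamma> \<in> keys (f * g)" for \<gamma>
  proof -
    obtain a b where "\<gamma> = a + b" "a \<in> keys f" "b \<in> keys g" using \<gamma> Poly_Mapping.keys_mult by blast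
    then show ?thesis using assms by (auto simp: monic_at_def le_fun_def lookup_add intro: add_mono)
  qed
  define f' where "f' = f - single \<alpha> 1"
  define g' where "g' = g - single \<beta> 1"
  have "lookup (single \<alpha> 1 * g') (\<alpha> + \<beta>) = 0"
  proof (rule ccontr)
    assume "lookup (single \<alpha> 1 * g') (\<alpha> + \<beta>) \<noteq> 0"
    then have "\<alpha> + \<beta> \<in> keys (single \<alpha> (1 :: 'b) * g')" by (simp add: in_keys_iff)
    then obtain a b where "\<alpha> + \<beta> = a + b" "a \<in> keys (single \<alpha> (1 :: 'b))" "b \<in> keys g'"
      using Poly_Mapping.keys_mult by blast
    then have "\<beta> \<in> keys g'" by simp
    then show False using assms(2) by (simp add: g'_def in_keys_iff lookup_minus monic_at_def)
  qed
  moreover have "lookup (f' * g) (\<alpha> + \<beta>) = 0"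
  proof (rule ccontr)
    assume "lookup (f' * g) (\<alpha> + \<beta>) \<noteq> 0"
    then have "\<alpha> + \<beta> \<in> keys (f' * g)" by (simp add: in_keys_iff)
    then obtain a b where ab: "\<alpha> + \<beta> = a + b" "a \<in> keys f'" "b \<in> keys g"
      using Poly_Mapping.keys_mult by blast
    have a: "a \<noteq> \<alpha>" using ab(2) assms(1) by (auto simp: f'_def in_keys_iff lookup_minus monic_at_def)
    then have "a \<in> keys f" using ab(2) by (simp add: f'_def in_keys_iff lookup_minus lookup_single)
    then have le: "lookup a \<le> lookup \<alpha>" "lookup b \<le> lookup \<beta>"
      using assms ab(3) by (auto simp: monic_at_def)
    have "lookup a j = lookup \<alpha> j" for j
    proof -
      have "lookup \<alpha> j + lookup \<beta> j = lookup a j + lookup b j"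
        using ab(1) by (metis lookup_add)
      then show ?thesis using le[THEN le_funD, of j] by simp
    qed
    then show False using a by (simp add: poly_mapping_eqI)
  qed
  moreover have "f * g = single \<alpha> 1 * single \<beta> 1 + single \<alpha> 1 * g' + f' * g"
    by (simp add: f'_def g'_def algebra_simps)
  ultimately have "lookup (f * g) (\<alpha> + \<beta>) = 1"
    by (simp add: lookup_add mult_single)
  then show ?thesis using le unfolding monic_at_def by blast
qed

lemma monic_at_prod:
  assumes "finite A" "\<And>i. i \<in> A \<Longrightarrow> monic_at (f i) (\<alpha> i)"
  shows "monic_at (\<Prod>i\<in>A. f i) (\<Sum>i\<in>A. \<alpha> i)"
  using assms by (induction A) (auto simp: monic_at_mult, simp add: monic_at_def)

lemma monic_at_linear: "monic_at (Var j - Const c) (single j 1)"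
proof -
  have "single j (1::nat) \<noteq> 0" by (metis lookup_single_eq lookup_zero zero_neq_one)
  then have "lookup (Var j - Const c) (single j 1) = 1"
    by (simp add: Var_def Const_def lookup_minus lookup_single when_def)
  moreover have "lookup \<gamma> \<le> lookup (single j 1)" if \<gamma>: "\<gamma> \<in> keys (Var j - Const c)" for \<gamma>
  proof -
    have "\<gamma> = single j 1 \<or> \<gamma> = 0"
      using \<gamma> unfolding Var_def Const_def
      by (auto simp: in_keys_iff lookup_minus lookup_single when_def split: if_splits)
    then show ?thesis by (auto simp: le_fun_def)
  qed
  ultimately show ?thesis unfolding monic_at_def by blast
qed

lemma basis_mpoly_monic:
  obtains \<alpha> where "lookup \<alpha> = i" "monic_at (basis_mpoly a i) \<alpha>"
proof
  show "monic_at (basis_mpoly a i) (\<Sum>j\<in>UNIV. \<Sum>t<i j. single j 1)"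
    unfolding basis_mpoly_def by (intro monic_at_prod monic_at_linear) auto
  show "lookup (\<Sum>j\<in>UNIV. \<Sum>t<i j. single j 1) = i"
    by (rule ext) (simp add: lookup_sum lookup_single when_def if_distrib[of "\<lambda>x. _ * x"] cong: if_cong)
qed

lemma supp_basis_mpoly: "supp (basis_mpoly a i) \<subseteq> {..i}"
  using basis_mpoly_monic[of i a] unfolding monic_at_def by (metis atMost_iff image_subsetI)

lemma eval_basis_mpoly: "eval s (basis_mpoly a i) = (\<Prod>j\<in>UNIV. \<Prod>t<i j. s j - a j t)"
  unfolding basis_mpoly_def by simp

lemma fmap_basis_mpoly: "fmap (basis_mpoly a i) = basis_mpoly (\<lambda>j t. to_fract (a j t)) i"
  unfolding basis_mpoly_def by (simp add: fmap_prod fmap_diff fmap_Const) (simp add: Var_def)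

lemma basis_mpoly_Suc:
  "basis_mpoly a (i(j := Suc (i j))) = basis_mpoly a i * (Var j - Const (a j (i j)))"
proof -
  have "(\<Prod>l\<in>UNIV - {j}. \<Prod>t<(i(j := Suc (i j))) l. Var l - Const (a l t)) =
      (\<Prod>l\<in>UNIV - {j}. \<Prod>t<i l. Var l - Const (a l t))" by (intro prod.cong) auto
  then show ?thesis unfolding basis_mpoly_def
    by (subst (1 2) prod.remove[of UNIV j]) (auto simp: ac_simps)
qed

text \<open>Induction on the total degree: multiplication by \<open>Var j\<close> raises the index
  of a basis polynomial at \<open>j\<close> by one and adds a constant multiple of the old
  one.\<close>

lemma monomial_mem_span_basis:
  "single \<alpha> 1 \<in> mpoly.span (basis_mpoly a ` {..lookup \<alpha>})"
proof (induction "\<Sum>j\<in>UNIV. lookup \<alpha> j" arbitrary: \<alpha>)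
  case 0
  then have "\<alpha> = 0" by (intro poly_mapping_eqI) simp
  then have "single \<alpha> 1 = basis_mpoly a (lookup \<alpha>)" unfolding basis_mpoly_def by simp
  then show ?case by (simp add: mpoly.span_base)
next
  case (Suc n)
  have "\<exists>j. lookup \<alpha> j \<noteq> 0"
  proof (rule ccontr)
    assume "\<not> ?thesis"
    then have "(\<Sum>j\<in>UNIV. lookup \<alpha> j) = 0" by simp
    then show False using Suc(2) by simp
  qed
  then obtain j where j: "lookup \<alpha> j \<noteq> 0" by blast
  define \<beta> where "\<beta> = \<alpha> - single j 1"
  have \<alpha>: "\<alpha> = single j 1 + \<beta>"
    by (rule poly_mapping_eqI) (use j in \<open>auto simp: \<beta>_def lookup_add lookup_minus lookup_single when_def\<close>)
  have "(\<Sum>l\<in>UNIV. lookup \<alpha> l) = (\<Sum>l\<in>UNIV. (if l = j then 1 else 0) + lookup \<beta> l)"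
    unfolding \<alpha> by (intro sum.cong) (auto simp: lookup_add lookup_single when_def)
  then have "n = (\<Sum>l\<in>UNIV. lookup \<beta> l)" using Suc(2) by (simp add: sum.distrib)
  then have IH: "single \<beta> 1 \<in> mpoly.span (basis_mpoly a ` {..lookup \<beta>})" by (rule Suc(1))
  let ?T = "mpoly.span (basis_mpoly a ` {..lookup \<alpha>})"
  have sub: "mpoly.subspace {f. Var j * f \<in> ?T}"
    by (rule mpoly.subspaceI)
      (auto simp: distrib_left mult.left_commute[of "Var j"] intro: mpoly.span_add mpoly.span_scale mpoly.span_zero)
  have "basis_mpoly a ` {..lookup \<beta>} \<subseteq> {f. Var j * f \<in> ?T}"
  proof clarsimp
    fix i assume i: "i \<le> lookup \<beta>"
    have "i(j := Suc (i j)) \<le> lookup \<alpha>" "i \<le> lookup \<alpha>"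
      using i unfolding \<alpha> by (auto simp: le_fun_def lookup_add lookup_single when_def le_SucI)
    then have "basis_mpoly a (i(j := Suc (i j))) + Const (a j (i j)) * basis_mpoly a i \<in> ?T"
      by (intro mpoly.span_add mpoly.span_scale mpoly.span_base) auto
    moreover have "Var j * basis_mpoly a i =
        basis_mpoly a (i(j := Suc (i j))) + Const (a j (i j)) * basis_mpoly a i"
      unfolding basis_mpoly_Suc by (simp add: algebra_simps)
    ultimately show "Var j * basis_mpoly a i \<in> ?T" by simp
  qed
  then have "Var j * single \<beta> 1 \<in> ?T" using mpoly.span_minimal[OF _ sub] IH by blast
  then show ?case unfolding Var_def by (simp add: mult_single \<alpha>)
qed

lemma basis_expansion:
  fixes f :: "('n::finite, 'a::comm_ring_1) mpoly"
  assumes "supp f \<subseteq> multi_indices m k"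
  obtains b where "f = (\<Sum>i\<in>multi_indices m k. Const (b i) * basis_mpoly a i)"
proof -
  let ?T = "mpoly.span (basis_mpoly a ` multi_indices m k)"
  have "single \<alpha> 1 \<in> ?T" if "\<alpha> \<in> keys f" for \<alpha>
  proof -
    have "{..lookup \<alpha>} \<subseteq> multi_indices m k" using that assms multi_indices_down by fastforce
    from mpoly.span_mono[OF image_mono[OF this]] show ?thesis
      using monomial_mem_span_basis by (rule subsetD)
  qed
  then have "(\<Sum>\<alpha>\<in>keys f. Const (lookup f \<alpha>) * single \<alpha> 1) \<in> ?T"
    by (intro mpoly.span_sum mpoly.span_scale)
  also have "(\<Sum>\<alpha>\<in>keys f. Const (lookup f \<alpha>) * single \<alpha> 1) = f"
    by (rule poly_mapping_eqI)
      (simp add: Const_mult_single lookup_sum lookup_single when_def in_keys_iff)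
  finally have "f \<in> ?T" .
  then show ?thesis by (rule mpoly.span_image_sum[OF finite_multi_indices]) (rule that)
qed

section \<open>The ideals of denominators\<close>

lemma range_to_fract_add: "x \<in> range to_fract \<Longrightarrow> y \<in> range to_fract \<Longrightarrow> x + y \<in> range to_fract"
  by (clarsimp simp flip: to_fract_add)

lemma range_to_fract_diff: "x \<in> range to_fract \<Longrightarrow> y \<in> range to_fract \<Longrightarrow> x - y \<in> range to_fract"
  by (clarsimp simp flip: to_fract_diff)

lemma range_to_fract_mult: "x \<in> range to_fract \<Longrightarrow> y \<in> range to_fract \<Longrightarrow> x * y \<in> range to_fract"
  by (clarsimp simp flip: to_fract_mult)

lemma range_to_fract_sum:
  "(\<And>i. i \<in> A \<Longrightarrow> f i \<in> range to_fract) \<Longrightarrow> sum f A \<in> range to_fract"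
proof (induction A rule: infinite_finite_induct)
  case (insert i A)
  then show ?case by (simp add: range_to_fract_add)
qed (metis rangeI to_fract_0 sum.infinite sum.empty)+

lemma divide_mem_range_to_fract_iff:
  assumes "d \<noteq> 0"
  shows "to_fract x / to_fract d \<in> range to_fract \<longleftrightarrow> d dvd x"
proof
  assume "to_fract x / to_fract d \<in> range to_fract"
  then obtain v where "to_fract x / to_fract d = to_fract v" by auto
  then have "to_fract x = to_fract (d * v)" using assms by (simp add: field_simps)
  then have "x = d * v" by (simp only: to_fract_eq_iff)
  then show "d dvd x" by simp
next
  assume "d dvd x"
  then obtain v where "x = d * v" ..
  then have "to_fract x / to_fract d = to_fract v" using assms by simp
  then show "to_fract x / to_fract d \<in> range to_fract" by simp
qed

lemma supp_Const_mult: "supp (Const c * f) \<subseteq> supp f"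
  for f :: "('n, 'a::comm_semiring_1) mpoly"
  by (intro image_mono) (auto simp: in_keys_iff lookup_Const_mult)

lemma Int_mpolys_iff:
  "g \<in> Int_mpolys m k S \<longleftrightarrow>
    (\<forall>s\<in>Pi UNIV S. eval (\<lambda>j. to_fract (s j)) g \<in> range to_fract) \<and> supp g \<subseteq> multi_indices m k"
  unfolding Int_mpolys_def mem_Collect_eq mdeg_tdeg_le_iff by blast

lemma Gamma_ideal_iff:
  "a \<in> Gamma_ideal m k S \<longleftrightarrow>
    (\<forall>g\<in>Int_mpolys m k S. \<forall>\<alpha>. to_fract a * lookup g \<alpha> \<in> range to_fract)"
  unfolding Gamma_ideal_def integral_mpolys_def by (simp add: lookup_Const_mult)

lemma subspace_Gamma_ideal: "ideal.subspace (Gamma_ideal m k S)"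
proof (rule ideal.subspaceI)
  show "0 \<in> Gamma_ideal m k S" unfolding Gamma_ideal_iff
    by (metis mult_zero_left rangeI to_fract_0)
next
  fix x y assume "x \<in> Gamma_ideal m k S" "y \<in> Gamma_ideal m k S"
  then show "x + y \<in> Gamma_ideal m k S" unfolding Gamma_ideal_iff
    by (simp add: distrib_right range_to_fract_add)
next
  fix c x assume "x \<in> Gamma_ideal m k S"
  then show "c * x \<in> Gamma_ideal m k S" unfolding Gamma_ideal_iff
    by (simp add: mult.assoc range_to_fract_mult)
qed

lemma Gamma_ideal_antimono:
  assumes "multi_indices m k \<subseteq> multi_indices m' k'"
  shows "Gamma_ideal m' k' S \<subseteq> Gamma_ideal m k S"
proof -
  have "Int_mpolys m k S \<subseteq> Int_mpolys m' k' S"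
    unfolding subset_iff[of "Int_mpolys m k S"] Int_mpolys_iff using subset_trans[OF _ assms] by simp
  then show ?thesis unfolding Gamma_ideal_def by blast
qed

lemma subspace_fixed_divisor: "ideal.subspace (fixed_divisor S f)"
  unfolding fixed_divisor_def by (rule ideal.subspace_span)

lemma eval_mem_fixed_divisor: "s \<in> Pi UNIV S \<Longrightarrow> eval s f \<in> fixed_divisor S f"
  unfolding fixed_divisor_def by (intro ideal.span_base) auto

lemma zero_mem_multi_indices: "(\<lambda>_. 0) \<in> multi_indices m k"
  unfolding multi_indices_def by (simp add: le_fun_def)

lemma Const_mem_Int_mpolys: "c \<in> range to_fract \<Longrightarrow> Const c \<in> Int_mpolys m k S"
  unfolding Int_mpolys_iff using zero_mem_multi_indices
  by (auto simp: in_keys_iff lookup_Const lookup_zero fun_eq_iff split: if_splits cong: if_cong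
      intro: back_subst[of "\<lambda>i. i \<in> multi_indices m k", OF zero_mem_multi_indices])

subsection \<open>Nodes of the basis polynomials\<close>

definition node :: "('n \<Rightarrow> nat \<Rightarrow> 'a) \<Rightarrow> ('n \<Rightarrow> nat) \<Rightarrow> 'n \<Rightarrow> 'a" where
  "node a l = (\<lambda>j. a j (l j))"

text \<open>With \<open>0, 1, 2, ...\<close> as points in every coordinate this is the product of
  the factorials of the \<open>i j\<close>; for \<open>P\<close>-orderings it generates locally the
  product of Bhargava's generalized factorials.\<close>

definition pivot :: "('n::finite \<Rightarrow> nat \<Rightarrow> 'a::comm_ring_1) \<Rightarrow> ('n \<Rightarrow> nat) \<Rightarrow> 'a" where
  "pivot a i = eval (node a i) (basis_mpoly a i)"

lemma eval_node_basis_zero: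
  assumes "\<not> i \<le> l"
  shows "eval (node a l) (basis_mpoly a i) = 0"
proof -
  obtain j where j: "l j < i j" using assms by (auto simp: le_fun_def not_le)
  then have "(\<Prod>t<i j. a j (l j) - a j t) = 0" by (intro prod_zero) auto
  then show ?thesis unfolding eval_basis_mpoly node_def by (intro prod_zero) auto
qed

text \<open>Same node, fewer factors: the value is the subproduct of \<open>pivot a i\<close> over
  \<open>t < l j\<close>.\<close>

lemma eval_node_basis_dvd_pivot:
  assumes "l \<le> i"
  shows "eval (node a i) (basis_mpoly a l) dvd pivot a i"
  unfolding pivot_def eval_basis_mpoly node_def
  using assms by (intro prod_dvd_prod prod_dvd_prod_subset) (auto simp: le_fun_def intro: less_le_trans)

lemma eval_fract_node_basis:
  "eval (\<lambda>j. to_fract (s j)) (basis_mpoly (\<lambda>j t. to_fract (c j t)) i) = to_fract (eval s (basis_mpoly c i))"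
  by (simp flip: fmap_basis_mpoly)

lemma sum_strict_less:
  fixes i l :: "'n::finite \<Rightarrow> nat"
  assumes "i \<le> l" "i \<noteq> l"
  shows "(\<Sum>j\<in>UNIV. i j) < (\<Sum>j\<in>UNIV. l j)"
proof -
  obtain j where "i j \<noteq> l j" using assms(2) by auto
  then have "i j < l j" using assms(1) by (simp add: le_fun_def order_le_neq_trans)
  then show ?thesis using assms(1)
    by (intro sum_strict_mono_ex1) (auto simp: le_fun_def)
qed

text \<open>One multiplier \<open>d\<close> has to serve all integer-valued \<open>g\<close>, so
  that finitely many multipliers can be collected into a product. Quantifying over every expansion
  \<open>b\<close> avoids an appeal to its uniqueness.\<close>

definition clears_coefficient ::
    "('n::finite \<Rightarrow> 'a::idom set) \<Rightarrow> ('n \<Rightarrow> nat \<Rightarrow> 'a) \<Rightarrow> ('n \<Rightarrow> nat) \<Rightarrow> ('n \<Rightarrow> nat) \<Rightarrow> 'a \<Rightarrow> bool" where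
  "clears_coefficient S c m l d \<longleftrightarrow> (\<forall>b. \<forall>g\<in>Int_mpolys m (\<Sum>j\<in>UNIV. m j) S.
    g = (\<Sum>i\<in>{..m}. Const (b i) * basis_mpoly (\<lambda>j t. to_fract (c j t)) i) \<longrightarrow>
      to_fract d * b l \<in> range to_fract)"

lemma clears_coefficientD:
  assumes "clears_coefficient S c m l d" "g \<in> Int_mpolys m (\<Sum>j\<in>UNIV. m j) S"
    and "g = (\<Sum>i\<in>{..m}. Const (b i) * basis_mpoly (\<lambda>j t. to_fract (c j t)) i)"
  shows "to_fract d * b l \<in> range to_fract"
  using assms unfolding clears_coefficient_def by blast

text \<open>The evaluation matrix of the basis polynomials at the nodes is triangular, so forward
  substitution controls the denominators of the coefficients of an integer-valued polynomial.\<close>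

lemma coefficient_denominator:
  fixes c :: "'n::finite \<Rightarrow> nat \<Rightarrow> 'a::idom"
  assumes P: "prime_ideal P" and c: "\<And>j t. c j t \<in> S j"
    and dvd: "\<And>l i. l \<le> i \<Longrightarrow> \<exists>s. s \<notin> P \<and> pivot c l dvd s * eval (node c i) (basis_mpoly c l)"
    and "l \<le> m"
  shows "\<exists>s. s \<notin> P \<and> clears_coefficient S c m l (s * pivot c l)"
  using assms(4)
proof (induction l rule: measure_induct_rule[of "\<lambda>l. \<Sum>j\<in>UNIV. l j"])
  case (less l)
  let ?B = "basis_mpoly (\<lambda>j t. to_fract (c j t))"
  let ?N = "\<lambda>i l. eval (node c l) (basis_mpoly c i)"
  let ?G = "Int_mpolys m (\<Sum>j\<in>UNIV. m j) S"
  let ?I = "{..l} - {l}"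
  have "\<forall>i\<in>?I. \<exists>s. s \<notin> P \<and> clears_coefficient S c m i (s * pivot c i)"
    using less sum_strict_less by (auto intro: order_trans)
  then obtain s where s: "\<And>i. i \<in> ?I \<Longrightarrow> s i \<notin> P"
    "\<And>i. i \<in> ?I \<Longrightarrow> clears_coefficient S c m i (s i * pivot c i)"
    by metis
  have "\<forall>i\<in>?I. \<exists>s. s \<notin> P \<and> pivot c i dvd s * ?N i l" using dvd by auto
  then obtain \<sigma> where \<sigma>: "\<And>i. i \<in> ?I \<Longrightarrow> \<sigma> i \<notin> P" "\<And>i. i \<in> ?I \<Longrightarrow> pivot c i dvd \<sigma> i * ?N i l"
    by metis
  \<comment> \<open>For each lower index, \<open>s i\<close> together with the pivot clears the
    coefficient \<open>b i\<close>, and \<open>\<sigma> i\<close> makes the pivot divide the matrix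
    entry; the product \<open>t\<close> does both for all of them.\<close>
  define t where "t = (\<Prod>i\<in>?I. s i * \<sigma> i)"
  have "t \<notin> P" unfolding t_def using s(1) \<sigma>(1) by (intro prime_ideal_prod[OF P] prime_ideal_mult[OF P])
  moreover have "to_fract (t * pivot c l) * b l \<in> range to_fract"
    if g: "g \<in> ?G" "g = (\<Sum>i\<in>{..m}. Const (b i) * ?B i)" for b g
  proof -
    have "eval (\<lambda>j. to_fract (node c l j)) g = (\<Sum>i\<in>{..m}. b i * to_fract (?N i l))"
      unfolding g(2) by (simp add: eval_fract_node_basis)
    also have "\<dots> = (\<Sum>i\<in>{..l}. b i * to_fract (?N i l))"
      by (rule sum.mono_neutral_right)
        (use less.prems in \<open>auto simp: finite_atMost_fun eval_node_basis_zero intro: order_trans\<close>)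
    also have "\<dots> = b l * to_fract (pivot c l) + (\<Sum>i\<in>?I. b i * to_fract (?N i l))"
      unfolding pivot_def by (subst sum.remove[of _ l]) (auto simp: finite_atMost_fun)
    finally have "to_fract (t * pivot c l) * b l =
        to_fract t * eval (\<lambda>j. to_fract (node c l j)) g - (\<Sum>i\<in>?I. to_fract t * (b i * to_fract (?N i l)))"
      unfolding sum_distrib_left[symmetric] by (simp add: algebra_simps)
    also have "\<dots> \<in> range to_fract"
    proof (rule range_to_fract_diff[OF range_to_fract_mult[OF rangeI] range_to_fract_sum])
      have "node c l \<in> Pi UNIV S" using c by (simp add: node_def)
      then show "eval (\<lambda>j. to_fract (node c l j)) g \<in> range to_fract"
        using g(1) unfolding Int_mpolys_iff by blast
    next
      fix i assume i: "i \<in> ?I"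
      obtain w where w: "\<sigma> i * ?N i l = pivot c i * w" using \<sigma>(2)[OF i] by auto
      define u where "u = (\<Prod>i\<in>?I - {i}. s i * \<sigma> i)"
      have t: "t = s i * \<sigma> i * u"
        unfolding t_def u_def using i by (intro prod.remove) (auto simp: finite_atMost_fun)
      have "to_fract t * (b i * to_fract (?N i l)) = to_fract (u * s i) * to_fract (\<sigma> i * ?N i l) * b i"
        unfolding t by (simp add: ac_simps)
      also have "\<dots> = to_fract (u * w) * (to_fract (s i * pivot c i) * b i)"
        unfolding w by (simp add: ac_simps)
      also have "\<dots> \<in> range to_fract"
        by (rule range_to_fract_mult[OF rangeI clears_coefficientD[OF s(2)[OF i] g]])
      finally show "to_fract t * (b i * to_fract (?N i l)) \<in> range to_fract" .
    qed
    finally show ?thesis .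
  qed
  ultimately show ?case unfolding clears_coefficient_def by blast
qed

text \<open>Each lower pivot divides, up to a local unit, the value of its basis polynomial at the
  node of \<open>m\<close>, and that value divides \<open>pivot c m\<close>. So a multiple of
  \<open>pivot c m\<close> by an element outside \<open>P\<close> clears all coefficients at once,
  and the basis polynomials themselves are integral.\<close>

lemma pivot_mem_loc_Gamma_ideal:
  fixes c :: "'n::finite \<Rightarrow> nat \<Rightarrow> 'a::idom"
  assumes P: "prime_ideal P" and c: "\<And>j t. c j t \<in> S j"
    and dvd: "\<And>l i. l \<le> i \<Longrightarrow> \<exists>s. s \<notin> P \<and> pivot c l dvd s * eval (node c i) (basis_mpoly c l)"
  shows "pivot c m \<in> loc P (Gamma_ideal m (\<Sum>j\<in>UNIV. m j) S)"
proof -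
  let ?B = "basis_mpoly (\<lambda>j t. to_fract (c j t))"
  let ?G = "Int_mpolys m (\<Sum>j\<in>UNIV. m j) S"
  have "\<forall>l\<in>{..m}. \<exists>s. s \<notin> P \<and> clears_coefficient S c m l (s * pivot c l)"
    using coefficient_denominator[OF assms] by auto
  then obtain s where s: "\<And>l. l \<in> {..m} \<Longrightarrow> s l \<notin> P"
    "\<And>l. l \<in> {..m} \<Longrightarrow> clears_coefficient S c m l (s l * pivot c l)"
    by metis
  have "\<forall>l\<in>{..m}. \<exists>s. s \<notin> P \<and> pivot c l dvd s * pivot c m"
    using dvd eval_node_basis_dvd_pivot[of _ m c] by (meson atMost_iff dvd_trans mult_dvd_mono dvd_refl)
  then obtain \<sigma> where \<sigma>: "\<And>l. l \<in> {..m} \<Longrightarrow> \<sigma> l \<notin> P"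
    "\<And>l. l \<in> {..m} \<Longrightarrow> pivot c l dvd \<sigma> l * pivot c m"
    by metis
  define t where "t = (\<Prod>l\<in>{..m}. s l * \<sigma> l)"
  have "t \<notin> P" unfolding t_def using s(1) \<sigma>(1) by (intro prime_ideal_prod[OF P] prime_ideal_mult[OF P])
  moreover have "t * pivot c m \<in> Gamma_ideal m (\<Sum>j\<in>UNIV. m j) S"
    unfolding Gamma_ideal_iff
  proof (intro ballI allI)
    fix g \<alpha> assume g: "g \<in> ?G"
    then have "supp g \<subseteq> multi_indices m (\<Sum>j\<in>UNIV. m j)" unfolding Int_mpolys_iff by blast
    then obtain b where b: "g = (\<Sum>i\<in>{..m}. Const (b i) * ?B i)"
      using basis_expansion[of g m "\<Sum>j\<in>UNIV. m j"] unfolding multi_indices_self by blast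
    have "to_fract (t * pivot c m) * b l \<in> range to_fract" if l: "l \<in> {..m}" for l
    proof -
      obtain w where w: "\<sigma> l * pivot c m = pivot c l * w" using \<sigma>(2)[OF l] by auto
      define u where "u = (\<Prod>i\<in>{..m} - {l}. s i * \<sigma> i)"
      have t: "t = s l * \<sigma> l * u"
        unfolding t_def u_def using l by (intro prod.remove) (auto simp: finite_atMost_fun)
      have "to_fract (t * pivot c m) * b l = to_fract (u * s l) * to_fract (\<sigma> l * pivot c m) * b l"
        unfolding t by (simp add: ac_simps)
      also have "\<dots> = to_fract (u * w) * (to_fract (s l * pivot c l) * b l)"
        unfolding w by (simp add: ac_simps)
      also have "\<dots> \<in> range to_fract"
        by (rule range_to_fract_mult[OF rangeI clears_coefficientD[OF s(2)[OF l] g b]])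
      finally show ?thesis .
    qed
    moreover have "lookup (?B l) \<alpha> \<in> range to_fract" for l
      by (simp flip: fmap_basis_mpoly)
    ultimately have "(\<Sum>l\<in>{..m}. (to_fract (t * pivot c m) * b l) * lookup (?B l) \<alpha>) \<in> range to_fract"
      by - (rule range_to_fract_sum, rule range_to_fract_mult)
    then show "to_fract (t * pivot c m) * lookup g \<alpha> \<in> range to_fract"
      unfolding b by (simp add: lookup_sum lookup_Const_mult sum_distrib_left mult.assoc)
  qed
  ultimately show ?thesis by (rule locI)
qed

text \<open>The polynomial \<open>s / d\<close> times \<open>basis_mpoly c i\<close> is
  integer-valued and has \<open>s / d\<close> as a coefficient, so \<open>\<gamma>\<close> must
  clear this fraction.\<close>

lemma pivot_dvd_Gamma_ideal:
  fixes c :: "'n::finite \<Rightarrow> nat \<Rightarrow> 'a::idom"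
  assumes "d \<noteq> 0" "\<And>x. x \<in> Pi UNIV S \<Longrightarrow> d dvd s * eval x (basis_mpoly c i)"
    and "\<gamma> \<in> Gamma_ideal i (\<Sum>j\<in>UNIV. i j) S"
  shows "d dvd s * \<gamma>"
proof -
  let ?g = "Const (to_fract s / to_fract d) * fmap (basis_mpoly c i)"
  obtain \<alpha> where \<alpha>: "lookup (basis_mpoly c i) \<alpha> = 1"
    using basis_mpoly_monic[of i c] unfolding monic_at_def by metis
  have "eval (\<lambda>j. to_fract (x j)) ?g \<in> range to_fract" if "x \<in> Pi UNIV S" for x
    using assms(2)[OF that] divide_mem_range_to_fract_iff[OF assms(1), of "s * eval x (basis_mpoly c i)"]
    by simp
  moreover have "supp ?g \<subseteq> multi_indices i (\<Sum>j\<in>UNIV. i j)"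
    unfolding multi_indices_self
    using supp_Const_mult[of _ "fmap (basis_mpoly c i)"] supp_basis_mpoly[of c i] by simp blast
  ultimately have "?g \<in> Int_mpolys i (\<Sum>j\<in>UNIV. i j) S" unfolding Int_mpolys_iff by blast
  then have "to_fract \<gamma> * lookup ?g \<alpha> \<in> range to_fract" using assms(3) unfolding Gamma_ideal_iff by blast
  also have "to_fract \<gamma> * lookup ?g \<alpha> = to_fract (s * \<gamma>) / to_fract d"
    by (simp add: lookup_Const_mult \<alpha>)
  finally show ?thesis by (simp only: divide_mem_range_to_fract_iff[OF assms(1)])
qed

section \<open>Fixed divisors\<close>

context
  fixes S :: "'n::finite \<Rightarrow> 'a::idom set"
  assumes vanishing: "vanishing_ideal S = {0}"
begin

lemma exists_eval_nonzero:
  assumes "f \<noteq> 0"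
  obtains s where "s \<in> Pi UNIV S" "eval s f \<noteq> 0"
proof -
  have "fmap f \<notin> vanishing_ideal S" using assms vanishing by simp
  then show ?thesis using that unfolding vanishing_ideal_def by auto
qed

text \<open>For finite \<open>S j\<close>, the product of \<open>x_j - h\<close> over all
  \<open>h \<in> S j\<close> vanishes on the product set; it is the basis polynomial whose points
  enumerate \<open>S j\<close>.\<close>

lemma infinite_factor: "infinite (S j)"
proof
  assume "finite (S j)"
  then obtain h where h: "bij_betw h {0..<card (S j)} (S j)" using ex_bij_betw_nat_finite by blast
  define i where "i l = (if l = j then card (S j) else 0)" for l
  obtain \<alpha> where "lookup (basis_mpoly (\<lambda>_. h) i :: ('n, 'a) mpoly) \<alpha> = 1"
    using basis_mpoly_monic unfolding monic_at_def by metis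
  then have "(basis_mpoly (\<lambda>_. h) i :: ('n, 'a) mpoly) \<noteq> 0" by auto
  then obtain s where s: "s \<in> Pi UNIV S" "eval s (basis_mpoly (\<lambda>_. h) i) \<noteq> 0"
    by (rule exists_eval_nonzero)
  have "s j \<in> h ` {0..<card (S j)}" using h s(1) unfolding bij_betw_def by auto
  then obtain t where "t < card (S j)" "s j = h t" by auto
  then have "(\<Prod>t<i j. s j - h t) = 0" by (intro prod_zero) (auto simp: i_def)
  then have "eval s (basis_mpoly (\<lambda>_. h) i) = 0"
    unfolding eval_basis_mpoly by (intro prod_zero) auto
  then show False using s(2) by simp
qed

lemma exists_point: obtains s where "s \<in> Pi UNIV S"
  using exists_eval_nonzero[of 1] zero_neq_one by metis

lemma fixed_divisor_nonzero: "f \<noteq> 0 \<Longrightarrow> fixed_divisor S f \<noteq> {0}"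
  using exists_eval_nonzero[of f] eval_mem_fixed_divisor[of _ S f] by auto

text \<open>Distinct points of the infinite sets \<open>S j\<close> give nonzero pivots. At the
  prime \<open>{0}\<close> these are local units, so the divisibility required of the nodes holds
  with the pivot itself as multiplier.\<close>

lemma Gamma_ideal_nonzero: "Gamma_ideal m k S \<noteq> {0}"
proof -
  have "\<forall>j. \<exists>f::nat \<Rightarrow> 'a. inj f \<and> range f \<subseteq> S j"
    using infinite_factor infinite_countable_subset by blast
  then obtain c :: "'n \<Rightarrow> nat \<Rightarrow> 'a" where c: "\<And>j. inj (c j)" "\<And>j. range (c j) \<subseteq> S j" by metis
  have piv: "pivot c i \<noteq> 0" for i
    unfolding pivot_def eval_basis_mpoly node_def using c(1) by (auto simp: inj_eq)
  have P: "prime_ideal ({0} :: 'a set)"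
  proof -
    have "(1::'a) \<notin> {0}" by simp
    then have "({0} :: 'a set) \<noteq> UNIV" by blast
    then show ?thesis unfolding prime_ideal_def by auto
  qed
  have "pivot c m \<in> loc {0} (Gamma_ideal m (\<Sum>j\<in>UNIV. m j) S)"
  proof (rule pivot_mem_loc_Gamma_ideal[OF P])
    show "\<exists>s. s \<notin> {0} \<and> pivot c l dvd s * eval (node c i) (basis_mpoly c l)" for l i
      using piv by (intro exI[of _ "pivot c l"]) simp
  qed (use c(2) in auto)
  then obtain s where "s \<noteq> 0" "s * pivot c m \<in> Gamma_ideal m (\<Sum>j\<in>UNIV. m j) S" by (auto elim!: locE)
  moreover have "multi_indices m k \<subseteq> multi_indices m (\<Sum>j\<in>UNIV. m j)"
    unfolding multi_indices_self by (auto simp: multi_indices_def)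
  then have "Gamma_ideal m (\<Sum>j\<in>UNIV. m j) S \<subseteq> Gamma_ideal m k S" by (rule Gamma_ideal_antimono)
  ultimately show ?thesis using piv[of m] by (metis mult_eq_0_iff singletonD subsetD)
qed

end

section \<open>Primitivity, and congruences of values modulo an ideal\<close>

lemma primitive_not_all_mem_prime:
  assumes "primitive f" "prime_ideal P"
  shows "\<exists>\<alpha>. lookup f \<alpha> \<notin> P"
proof (rule ccontr)
  assume "\<not> ?thesis"
  then have "lookup f ` keys f \<subseteq> P" by auto
  then have "ideal.span (lookup f ` keys f) \<subseteq> P"
    using prime_idealD(1)[OF assms(2)] by (rule ideal.span_minimal)
  then show False using assms prime_idealD(2)[OF assms(2)] unfolding primitive_def by auto
qed

lemma primitive_nonzero: "primitive (f :: ('n, 'a::idom) mpoly) \<Longrightarrow> f \<noteq> 0"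
  unfolding primitive_def by (auto dest: arg_cong[of _ _ "\<lambda>A. 1 \<in> A"])

lemma ideal_mult_cong:
  assumes "ideal.subspace Q" "a - a' \<in> Q" "b - b' \<in> Q"
  shows "a * b - a' * b' \<in> Q"
proof -
  have "a * b - a' * b' = b * (a - a') + a' * (b - b')" by (simp add: algebra_simps)
  then show ?thesis using assms by (simp add: ideal.subspace_add ideal.subspace_scale)
qed

lemma ideal_prod_cong:
  assumes "ideal.subspace Q" "\<And>j. j \<in> A \<Longrightarrow> g j - h j \<in> Q"
  shows "(\<Prod>j\<in>A. g j) - (\<Prod>j\<in>A. h j) \<in> Q"
  using assms(2) ideal.subspace_0[OF assms(1)]
  by (induction A rule: infinite_finite_induct) (auto intro: ideal_mult_cong[OF assms(1)])

lemma ideal_power_cong: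
  assumes "ideal.subspace Q" "a - a' \<in> Q"
  shows "a ^ n - a' ^ n \<in> Q"
  using ideal_prod_cong[OF assms(1), of "{..<n}" "\<lambda>_. a" "\<lambda>_. a'"] assms(2) by simp

lemma eval_cong_ideal:
  fixes f :: "('n::finite, 'a::comm_ring_1) mpoly"
  assumes Q: "ideal.subspace Q" and "\<And>j. x j - y j \<in> Q"
  shows "eval x f - eval y f \<in> Q"
proof (induction f rule: mpoly_induct)
  case (single \<alpha> c)
  show ?case unfolding eval_single right_diff_distrib[symmetric]
    by (intro ideal.subspace_scale[OF Q] ideal_prod_cong[OF Q] ideal_power_cong[OF Q] assms(2))
next
  case (add f g)
  then show ?case using ideal.subspace_add[OF Q, of "eval x f - eval y f" "eval x g - eval y g"]
    by (simp add: algebra_simps)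
qed

lemma basis_mpoly_cong_ideal:
  fixes a c :: "'n::finite \<Rightarrow> nat \<Rightarrow> 'a::comm_ring_1"
  assumes Q: "ideal.subspace Q" and "\<And>j. x j - y j \<in> Q" "\<And>j t. a j t - c j t \<in> Q"
  shows "eval x (basis_mpoly a i) - eval y (basis_mpoly c i) \<in> Q"
proof -
  have "x j - a j t - (y j - c j t) \<in> Q" for j t
    using ideal.subspace_diff[OF Q assms(2)[of j] assms(3)[of j t]] by (simp add: algebra_simps)
  then show ?thesis unfolding eval_basis_mpoly by (intro ideal_prod_cong[OF Q])
qed

section \<open>Primitive polynomials with a prescribed fixed divisor\<close>

context
  fixes S :: "'n::finite \<Rightarrow> 'a::idom set"
  assumes dedekind: "dedekind_domain TYPE('a)"
    and vanishing: "vanishing_ideal S = {0}"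
begin

lemma primitive_iff:
  fixes f :: "('n, 'a) mpoly"
  shows "primitive f \<longleftrightarrow> (\<forall>P. prime_ideal P \<longrightarrow> (\<exists>\<alpha>. lookup f \<alpha> \<notin> P))"
proof
  assume *: "\<forall>P. prime_ideal P \<longrightarrow> (\<exists>\<alpha>. lookup f \<alpha> \<notin> P)"
  show "primitive f" unfolding primitive_def
  proof (rule ccontr)
    assume "ideal.span (lookup f ` keys f) \<noteq> UNIV"
    then obtain P where P: "prime_ideal P" "ideal.span (lookup f ` keys f) \<subseteq> P"
      using proper_ideal_subset_prime[OF dedekind ideal.subspace_span] by blast
    have "lookup f \<alpha> \<in> P" for \<alpha>
    proof (cases "\<alpha> \<in> keys f")
      case True
      then show ?thesis using P(2) ideal.span_superset[of "lookup f ` keys f"] by blast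
    next
      case False
      then show ?thesis using prime_ideal_zero[OF P(1)] by (simp add: in_keys_iff)
    qed
    then show False using * P(1) by blast
  qed
qed (use primitive_not_all_mem_prime in blast)

text \<open>Locally the fixed divisor is generated by one element \<open>d\<close>, and \<open>f / d\<close> is integer-valued.\<close>

lemma Gamma_ideal_subset_fixed_divisor:
  fixes f :: "('n, 'a) mpoly"
  assumes "primitive f" "supp f \<subseteq> multi_indices m k"
  shows "Gamma_ideal m k S \<subseteq> fixed_divisor S f"
proof
  fix a assume a: "a \<in> Gamma_ideal m k S"
  show "a \<in> fixed_divisor S f"
  proof (rule mem_ideal_local[OF dedekind subspace_fixed_divisor])
    fix P :: "'a set" assume P: "prime_ideal P"
    obtain d s where d: "d \<in> fixed_divisor S f" "d \<noteq> 0" "s \<notin> P"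
      "\<And>x. x \<in> fixed_divisor S f \<Longrightarrow> d dvd s * x"
      by (rule locally_principal[OF dedekind subspace_fixed_divisor
            fixed_divisor_nonzero[OF vanishing primitive_nonzero[OF assms(1)]] P]) blast
    let ?g = "Const (to_fract s / to_fract d) * fmap f"
    have "eval (\<lambda>j. to_fract (x j)) ?g \<in> range to_fract" if "x \<in> Pi UNIV S" for x
      using d(4)[OF eval_mem_fixed_divisor[OF that]]
        divide_mem_range_to_fract_iff[OF d(2), of "s * eval x f"] by simp
    moreover have "supp ?g \<subseteq> multi_indices m k"
      using supp_Const_mult[of _ "fmap f"] assms(2) by simp blast
    ultimately have "?g \<in> Int_mpolys m k S" unfolding Int_mpolys_iff by blast
    then have *: "to_fract a * lookup ?g \<alpha> \<in> range to_fract" for \<alpha>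
      using a unfolding Gamma_ideal_iff by blast
    have "d dvd (a * s) * lookup f \<alpha>" for \<alpha>
    proof -
      have "to_fract a * lookup ?g \<alpha> = to_fract ((a * s) * lookup f \<alpha>) / to_fract d"
        by (simp add: lookup_Const_mult)
      then show ?thesis using *[of \<alpha>] by (simp only: divide_mem_range_to_fract_iff[OF d(2)])
    qed
    \<comment> \<open>Divisibility by \<open>d\<close> after multiplication by \<open>a * s\<close>
      passes from the coefficients to the ideal they generate, which contains \<open>1\<close> by
      primitivity.\<close>
    then have "lookup f ` keys f \<subseteq> {x. d dvd (a * s) * x}" by auto
    moreover have "ideal.subspace {x. d dvd (a * s) * x}"
      by (rule ideal.subspaceI) (auto simp: distrib_left mult.left_commute[of "a * s"])
    ultimately have "ideal.span (lookup f ` keys f) \<subseteq> {x. d dvd (a * s) * x}"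
      by (rule ideal.span_minimal)
    then have "d dvd (a * s) * 1" using assms(1) unfolding primitive_def by blast
    then obtain v where "(a * s) * 1 = d * v" ..
    then have "s * a = v * d" by (simp add: mult.commute)
    then have "s * a \<in> fixed_divisor S f"
      using ideal.subspace_scale[OF subspace_fixed_divisor d(1)] by simp
    then show "a \<in> loc P (fixed_divisor S f)" using d(3) by (intro locI)
  qed
qed

definition Gamma_valued :: "('n \<Rightarrow> nat) \<Rightarrow> nat \<Rightarrow> ('n, 'a) mpoly set" where
  "Gamma_valued m k = {f. supp f \<subseteq> multi_indices m k \<and>
     (\<forall>s\<in>Pi UNIV S. eval s f \<in> Gamma_ideal m k S)}"

lemma subspace_Gamma_valued: "mpoly.subspace (Gamma_valued m k)"
proof (rule mpoly.subspaceI)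
  show "0 \<in> Gamma_valued m k"
    using ideal.subspace_0[OF subspace_Gamma_ideal[of m k S]] by (simp add: Gamma_valued_def)
next
  fix f g assume fg: "f \<in> Gamma_valued m k" "g \<in> Gamma_valued m k"
  have "supp (f + g) \<subseteq> supp f \<union> supp g" using Poly_Mapping.keys_add[of f g] by blast
  then have "supp (f + g) \<subseteq> multi_indices m k"
    by (rule subset_trans) (use fg in \<open>simp add: Gamma_valued_def\<close>)
  then show "f + g \<in> Gamma_valued m k"
    using fg unfolding Gamma_valued_def by (simp add: ideal.subspace_add[OF subspace_Gamma_ideal])
next
  fix c f assume "f \<in> Gamma_valued m k"
  then show "Const c * f \<in> Gamma_valued m k"
    using subset_trans[OF supp_Const_mult[of c f]]
    unfolding Gamma_valued_def by (simp add: ideal.subspace_scale[OF subspace_Gamma_ideal])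
qed

lemma single_mem_Gamma_valued:
  assumes "\<gamma> \<in> Gamma_ideal m k S" "lookup \<alpha> \<in> multi_indices m k"
  shows "single \<alpha> \<gamma> \<in> Gamma_valued m k"
  using assms ideal.subspace_scale[OF subspace_Gamma_ideal assms(1)]
  unfolding Gamma_valued_def by (auto simp: eval_single mult.commute[of \<gamma>])

text \<open>Otherwise multiplication by \<open>P\<^sup>-\<^sup>1\<close> would map the nonzero ideal \<open>\<Gamma>\<close> into itself.\<close>

lemma Gamma_valued_not_all_mem_prime:
  assumes P: "prime_ideal P" and "P \<noteq> {0}"
  obtains f \<alpha> where "f \<in> Gamma_valued m k" "lookup f \<alpha> \<notin> P"
proof -
  let ?\<Gamma> = "Gamma_ideal m k S"
  have "\<exists>f\<in>Gamma_valued m k. \<exists>\<alpha>. lookup f \<alpha> \<notin> P"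
  proof (rule ccontr)
    assume "\<not> ?thesis"
    then have in_P: "\<And>f \<alpha>. f \<in> Gamma_valued m k \<Longrightarrow> lookup f \<alpha> \<in> P" by blast
    obtain t s where t: "t \<in> P" "t \<noteq> 0" "s \<notin> P" "\<And>x. x \<in> P \<Longrightarrow> t dvd s * x"
      by (rule uniformizer[OF dedekind assms]) blast
    obtain e s' where e: "e \<in> ?\<Gamma>" "e \<noteq> 0" "s' \<notin> P" "\<And>x. x \<in> ?\<Gamma> \<Longrightarrow> e dvd s' * x"
      by (rule locally_principal[OF dedekind subspace_Gamma_ideal
            Gamma_ideal_nonzero[OF vanishing] P]) blast
    \<comment> \<open>For integer-valued \<open>g\<close>, the multiple \<open>e * g\<close> has
      coefficients in the ring and values in \<open>\<Gamma>\<close>. By assumption its coefficients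
      then lie in \<open>P\<close>, so \<open>t\<close> divides them up to \<open>s\<close>.\<close>
    have coeff: "to_fract (s * e) / to_fract t * lookup g \<alpha> \<in> range to_fract"
      if g: "g \<in> Int_mpolys m k S" for g \<alpha>
    proof -
      have "Const (to_fract e) * g \<in> integral_mpolys" using e(1) g unfolding Gamma_ideal_def by blast
      then obtain f where f: "Const (to_fract e) * g = fmap f" unfolding integral_mpolys_iff by blast
      have "eval x f \<in> ?\<Gamma>" if x: "x \<in> Pi UNIV S" for x
      proof -
        obtain v where "eval (\<lambda>j. to_fract (x j)) g = to_fract v"
          using g x unfolding Int_mpolys_iff by blast
        then have "to_fract (eval x f) = to_fract (v * e)"
          using eval_fmap[of x f] unfolding f[symmetric] by (simp add: mult.commute)
        then have "eval x f = v * e" by (simp only: to_fract_eq_iff)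
        then show ?thesis using ideal.subspace_scale[OF subspace_Gamma_ideal e(1)] by simp
      qed
      moreover have "supp f \<subseteq> multi_indices m k"
      proof -
        have "supp f = supp (Const (to_fract e) * g)" unfolding f by simp
        then show ?thesis using supp_Const_mult[of "to_fract e" g] g unfolding Int_mpolys_iff by blast
      qed
      ultimately have "f \<in> Gamma_valued m k" unfolding Gamma_valued_def by blast
      then have "t dvd s * lookup f \<alpha>" using in_P t(4) by blast
      then have "to_fract (s * lookup f \<alpha>) / to_fract t \<in> range to_fract"
        by (simp only: divide_mem_range_to_fract_iff[OF t(2)])
      moreover have "to_fract (lookup f \<alpha>) = to_fract e * lookup g \<alpha>"
        using f by (metis lookup_Const_mult lookup_fmap)
      ultimately show ?thesis by (simp add: mult.assoc)
    qed
    \<comment> \<open>The constant \<open>1\<close> is integer-valued, so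
      \<open>z = s * e / t\<close> is in the ring, and \<open>coeff\<close> puts it into
      \<open>\<Gamma>\<close>. As a local multiple of \<open>e\<close> it would make
      \<open>1 / t\<close> locally integral, against \<open>t \<in> P\<close>.\<close>
    have "to_fract (s * e) / to_fract t \<in> range to_fract"
      using coeff[OF Const_mem_Int_mpolys[of 1 m k S], of 0] rangeI[of to_fract 1] by simp
    then have "t dvd s * e" by (simp only: divide_mem_range_to_fract_iff[OF t(2)])
    then obtain z where z: "s * e = t * z" ..
    have "to_fract (s * e) / to_fract t = to_fract z" unfolding z using t(2) by simp
    then have "z \<in> ?\<Gamma>" using coeff unfolding Gamma_ideal_iff by metis
    then have "e dvd s' * z" by (rule e(4))
    then obtain w where "s' * z = e * w" ..
    then have "e * (s' * s) = e * (t * w)" using z by (metis mult.left_commute mult.commute)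
    then have "s' * s = t * w" using e(2) by simp
    then have "s' * s \<in> P" using ideal.subspace_scale[OF prime_idealD(1)[OF P] t(1), of w]
      by (simp add: mult.commute)
    then show False using prime_ideal_mult[OF P e(3) t(3)] by blast
  qed
  then show ?thesis using that by blast
qed

text \<open>Prime avoidance gives an element whose content is prime to \<open>\<Gamma>\<close>. Its constant coefficient
  has only finitely many further prime factors, and these are removed from the content by changing
  a second coefficient modulo \<open>\<Gamma>\<close>.\<close>

lemma exists_primitive_Gamma_valued:
  obtains f where "f \<in> Gamma_valued m k" "primitive f" "supp f = multi_indices m k"
proof -
  let ?\<Gamma> = "Gamma_ideal m k S"
  let ?N = "Gamma_valued m k"
  let ?F = "{P. prime_ideal P \<and> ?\<Gamma> \<subseteq> P}"
  have \<Gamma>: "ideal.subspace ?\<Gamma>" by (rule subspace_Gamma_ideal)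
  obtain \<gamma>0 where \<gamma>0: "\<gamma>0 \<in> ?\<Gamma>" "\<gamma>0 \<noteq> 0"
    using Gamma_ideal_nonzero[OF vanishing] ideal.subspace_0[OF \<Gamma>] by blast
  have F: "P \<noteq> {0}" "maximal_ideal P" if "P \<in> ?F" for P
  proof -
    show "P \<noteq> {0}" using that \<gamma>0 by blast
    then show "maximal_ideal P" using that nonzero_prime_maximal[OF dedekind] by blast
  qed
  define E :: "('n \<Rightarrow>\<^sub>0 nat) set" where "E = {\<alpha>. lookup \<alpha> \<in> multi_indices m k}"
  have "inj (lookup :: ('n \<Rightarrow>\<^sub>0 nat) \<Rightarrow> _)" by (rule injI) (simp only: poly_mapping_eq_iff)
  then have "finite E" unfolding E_def
    using finite_vimageI[OF finite_multi_indices[of m k]] by (simp add: vimage_def)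
  have E: "lookup ` E = multi_indices m k"
  proof (intro equalityI subsetI)
    fix i assume "i \<in> multi_indices m k"
    moreover obtain \<alpha> where "lookup \<alpha> = i" by (rule obtain_exponent)
    ultimately show "i \<in> lookup ` E" unfolding E_def by blast
  qed (auto simp: E_def)
  have keys_E: "\<alpha> \<in> E" if "f \<in> ?N" "lookup f \<alpha> \<noteq> 0" for f \<alpha>
    using that unfolding Gamma_valued_def E_def by (auto simp: in_keys_iff)
  have "\<exists>f\<in>?N. \<forall>P\<in>?F. 0 + f \<notin> {f. \<forall>\<alpha>. lookup f \<alpha> \<in> P}"
  proof (rule mpoly.avoid_subspaces)
    show "finite ?F"
      by (rule finite_primes_containing[OF dedekind \<Gamma> Gamma_ideal_nonzero[OF vanishing]])
    show "mpoly.subspace ?N" by (rule subspace_Gamma_valued)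
    fix P assume P: "P \<in> ?F"
    then have sub: "ideal.subspace P" by (simp add: prime_idealD(1))
    show "maximal_ideal P" by (rule F(2)[OF P])
    show "mpoly.subspace {f. \<forall>\<alpha>. lookup f \<alpha> \<in> P}"
      using sub by (intro mpoly.subspaceI)
        (auto simp: lookup_add lookup_Const_mult ideal.subspace_0 ideal.subspace_add ideal.subspace_scale)
    show "Const p * f \<in> {f. \<forall>\<alpha>. lookup f \<alpha> \<in> P}" if "p \<in> P" for p f
      using ideal.subspace_scale[OF sub that] by (simp add: lookup_Const_mult mult.commute[of p])
    show "\<not> ?N \<subseteq> {f. \<forall>\<alpha>. lookup f \<alpha> \<in> P}"
      using Gamma_valued_not_all_mem_prime[of P m k] F(1)[OF P] P by blast
  qed
  then obtain f1 where f1: "f1 \<in> ?N" "\<And>P. P \<in> ?F \<Longrightarrow> \<exists>\<alpha>. lookup f1 \<alpha> \<notin> P" by auto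
  \<comment> \<open>The missing exponents are filled with \<open>\<gamma>0\<close>, which makes the
    support full. Coefficients of \<open>f1\<close> outside a prime are nonzero and hence left
    unchanged.\<close>
  define f2 where "f2 = f1 + (\<Sum>\<alpha>\<in>{\<alpha>\<in>E. lookup f1 \<alpha> = 0}. single \<alpha> \<gamma>0)"
  have lookup_f2: "lookup f2 \<alpha> = (if \<alpha> \<in> E \<and> lookup f1 \<alpha> = 0 then \<gamma>0 else lookup f1 \<alpha>)" for \<alpha>
    using \<open>finite E\<close> unfolding f2_def by (auto simp: lookup_add lookup_sum lookup_single when_def)
  have f2: "f2 \<in> ?N" unfolding f2_def
    using f1(1) \<gamma>0(1)
    by (intro mpoly.subspace_add mpoly.subspace_sum subspace_Gamma_valued single_mem_Gamma_valued)
      (auto simp: E_def)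
  have f2_E: "lookup f2 \<alpha> \<noteq> 0" if "\<alpha> \<in> E" for \<alpha> using that \<gamma>0(2) by (simp add: lookup_f2)
  have f2_P: "\<exists>\<alpha>. lookup f2 \<alpha> \<notin> P" if P: "P \<in> ?F" for P
  proof -
    obtain \<alpha> where "lookup f1 \<alpha> \<notin> P" using f1(2)[OF P] by blast
    then have "lookup f1 \<alpha> \<noteq> 0" using P prime_ideal_zero[of P] by auto
    then show ?thesis using \<open>lookup f1 \<alpha> \<notin> P\<close> by (intro exI[of _ \<alpha>]) (simp add: lookup_f2)
  qed
  have supp_eq: "supp f = multi_indices m k" if "f \<in> ?N" "\<And>\<alpha>. \<alpha> \<in> E \<Longrightarrow> lookup f \<alpha> \<noteq> 0" for f
  proof -
    have "keys f = E" using that keys_E by (auto simp: in_keys_iff)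
    then show ?thesis using E by simp
  qed
  have zero_E: "0 \<in> E" unfolding E_def
    using zero_mem_multi_indices[of m k] by (simp add: lookup_zero[abs_def])
  show ?thesis
  proof (cases "E = {0}")
    \<comment> \<open>With constants only, there is no second coefficient to adjust. But an
      integer-valued constant is an element of the ring, so \<open>\<Gamma>\<close> is the unit
      ideal and \<open>1\<close> serves.\<close>
    case True
    have "1 \<in> ?\<Gamma>" unfolding Gamma_ideal_iff
    proof (intro ballI allI)
      fix g \<alpha> assume g: "g \<in> Int_mpolys m k S"
      then have "keys g \<subseteq> E" unfolding Int_mpolys_iff E_def by blast
      then have "g = Const (lookup g 0)" using True
        by (intro poly_mapping_eqI) (auto simp: lookup_Const in_keys_iff)
      moreover obtain x where "x \<in> Pi UNIV S" by (rule exists_point[OF vanishing])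
      ultimately have "lookup g 0 \<in> range to_fract"
        using g unfolding Int_mpolys_iff by (metis eval_Const)
      moreover have "lookup g \<alpha> = 0" if "\<alpha> \<noteq> 0"
      proof -
        have "\<alpha> \<notin> keys g" using that \<open>keys g \<subseteq> E\<close> True by blast
        then show ?thesis by (simp add: in_keys_iff)
      qed
      ultimately have "lookup g \<alpha> \<in> range to_fract"
        using rangeI[of to_fract 0] by (cases "\<alpha> = 0") simp_all
      then show "to_fract 1 * lookup g \<alpha> \<in> range to_fract" by simp
    qed
    then have "1 \<in> ?N"
      using single_mem_Gamma_valued[of 1 m k 0] zero_E by (simp add: E_def)
    moreover have "primitive (1 :: ('n, 'a) mpoly)"
      unfolding primitive_iff using prime_idealD(2) lookup_one_zero by metis
    moreover have "supp (1 :: ('n, 'a) mpoly) = multi_indices m k"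
      using supp_eq[OF \<open>1 \<in> ?N\<close>] True by simp
    ultimately show ?thesis using that by blast
  next
    case False
    then obtain \<alpha>0 where \<alpha>0: "\<alpha>0 \<in> E" "\<alpha>0 \<noteq> 0" using zero_E by blast
    define q where "q = lookup f2 0"
    have q: "q \<noteq> 0" unfolding q_def by (rule f2_E[OF zero_E])
    \<comment> \<open>By \<open>f2_P\<close>, only these primes can contain all coefficients of
      \<open>f2\<close>; they are finitely many because \<open>q \<noteq> 0\<close>.\<close>
    let ?F2 = "{P. prime_ideal P \<and> q \<in> P \<and> \<not> ?\<Gamma> \<subseteq> P}"
    have "finite {P. prime_ideal P \<and> {x. q dvd x} \<subseteq> P}"
      using q by (intro finite_primes_containing[OF dedekind subspace_principal])
        (metis dvd_refl mem_Collect_eq singletonD)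
    moreover have "?F2 \<subseteq> {P. prime_ideal P \<and> {x. q dvd x} \<subseteq> P}"
    proof (clarsimp elim!: dvdE)
      fix P k assume "prime_ideal P" "q \<in> P"
      then show "q * k \<in> P" using ideal.subspace_scale[OF prime_idealD(1), of P q k]
        by (simp add: mult.commute)
    qed
    ultimately have "finite ?F2" by (rule finite_subset[rotated])
    have "\<exists>\<gamma>\<in>?\<Gamma>. \<forall>P\<in>?F2. lookup f2 \<alpha>0 + \<gamma> \<notin> P"
    proof (rule ideal.avoid_subspaces[OF \<open>finite ?F2\<close>])
      fix P assume P: "P \<in> ?F2"
      then show "ideal.subspace P" by (simp add: prime_idealD(1))
      then show "p * x \<in> P" if "p \<in> P" for p x
        using ideal.subspace_scale[of P p x] that by (simp add: mult.commute)
      show "maximal_ideal P" using P q by (intro nonzero_prime_maximal[OF dedekind]) auto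
    qed (use \<Gamma> in auto)
    then obtain \<gamma> where \<gamma>: "\<gamma> \<in> ?\<Gamma>" "\<forall>P\<in>?F2. lookup f2 \<alpha>0 + \<gamma> \<notin> P" by blast
    \<comment> \<open>If \<open>?F2\<close> is empty, avoidance says nothing about
      \<open>\<gamma>\<close>, which might cancel the coefficient at \<open>\<alpha>0\<close>; the
      default \<open>0\<close> preserves the full support.\<close>
    define \<gamma>' where "\<gamma>' = (if ?F2 = {} then 0 else \<gamma>)"
    have \<gamma>': "\<gamma>' \<in> ?\<Gamma>" "\<And>P. P \<in> ?F2 \<Longrightarrow> lookup f2 \<alpha>0 + \<gamma>' \<notin> P"
      using \<gamma> ideal.subspace_0[OF \<Gamma>] unfolding \<gamma>'_def by auto
    have nz: "lookup f2 \<alpha>0 + \<gamma>' \<noteq> 0"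
    proof (cases "?F2 = {}")
      case True
      then show ?thesis using f2_E[OF \<alpha>0(1)] by (simp add: \<gamma>'_def)
    next
      case False
      then obtain P where P: "P \<in> ?F2" by blast
      then have "0 \<in> P" using prime_ideal_zero[of P] by auto
      then show ?thesis using \<gamma>'(2)[OF P] by auto
    qed
    define f3 where "f3 = f2 + single \<alpha>0 \<gamma>'"
    have lookup_f3: "lookup f3 \<alpha> = (if \<alpha> = \<alpha>0 then lookup f2 \<alpha>0 + \<gamma>' else lookup f2 \<alpha>)" for \<alpha>
      unfolding f3_def by (auto simp: lookup_add lookup_single when_def)
    have f3: "f3 \<in> ?N" unfolding f3_def
      using f2 \<gamma>'(1) \<alpha>0(1)
      by (intro mpoly.subspace_add subspace_Gamma_valued single_mem_Gamma_valued) (auto simp: E_def)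
    \<comment> \<open>Modulo a prime containing \<open>\<Gamma>\<close> nothing has changed since
      \<open>f2\<close>. A prime containing \<open>q\<close> but not \<open>\<Gamma>\<close> misses
      the coefficient at \<open>\<alpha>0\<close>, and any other prime misses the constant
      coefficient \<open>q\<close>.\<close>
    have "\<exists>\<alpha>. lookup f3 \<alpha> \<notin> P" if P: "prime_ideal P" for P
    proof (cases "?\<Gamma> \<subseteq> P")
      case True
      then obtain \<alpha> where \<alpha>: "lookup f2 \<alpha> \<notin> P" using f2_P P by blast
      have "lookup f3 \<alpha> \<notin> P"
      proof (cases "\<alpha> = \<alpha>0")
        case True
        then show ?thesis
          using \<alpha> \<gamma>'(1) \<open>?\<Gamma> \<subseteq> P\<close> ideal.subspace_diff[OF prime_idealD(1)[OF P], of "lookup f2 \<alpha>0 + \<gamma>'" \<gamma>']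
          by (auto simp: lookup_f3)
      qed (use \<alpha> in \<open>simp add: lookup_f3\<close>)
      then show ?thesis by blast
    next
      case False
      show ?thesis
      proof (cases "q \<in> P")
        case True
        then show ?thesis using \<gamma>'(2)[of P] P False by (intro exI[of _ \<alpha>0]) (simp add: lookup_f3)
      next
        case False
        then show ?thesis using \<alpha>0(2) by (intro exI[of _ 0]) (auto simp: lookup_f3 q_def)
      qed
    qed
    then have "primitive f3" unfolding primitive_iff by blast
    moreover have "supp f3 = multi_indices m k"
      using nz f2_E by (intro supp_eq[OF f3]) (simp add: lookup_f3)
    ultimately show ?thesis using that f3 by blast
  qed
qed

lemma exists_primitive_fixed_divisor_Gamma:
  obtains f :: "('n, 'a) mpoly" where "primitive f" "supp f = multi_indices m k"
    "fixed_divisor S f = Gamma_ideal m k S"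
proof -
  obtain f where f: "f \<in> Gamma_valued m k" "primitive f" "supp f = multi_indices m k"
    by (rule exists_primitive_Gamma_valued)
  have "fixed_divisor S f \<subseteq> Gamma_ideal m k S"
    unfolding fixed_divisor_def using f(1)
    by (intro ideal.span_minimal subspace_Gamma_ideal) (auto simp: Gamma_valued_def)
  then show ?thesis using that f Gamma_ideal_subset_fixed_divisor[of f m k] by auto
qed

text \<open>If \<open>J = \<Gamma> + (c)\<close>, then adding \<open>c\<close> to a polynomial with fixed divisor \<open>\<Gamma>\<close> produces the fixed
  divisor \<open>J\<close>; changing \<open>c\<close> modulo \<open>\<Gamma>\<close> keeps the polynomial primitive.\<close>

lemma exists_primitive_fixed_divisor:
  assumes J: "ideal.subspace J" "Gamma_ideal m k S \<subseteq> J"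
    and mk: "Max (range m) \<le> k" "k \<le> (\<Sum>j\<in>UNIV. m j)"
  obtains f :: "('n, 'a) mpoly" where "primitive f" "of_type f m k" "fixed_divisor S f = J"
proof -
  let ?\<Gamma> = "Gamma_ideal m k S"
  obtain f0 where f0: "primitive f0" "supp f0 = multi_indices m k" "fixed_divisor S f0 = ?\<Gamma>"
    by (rule exists_primitive_fixed_divisor_Gamma)
  have type0: "of_type f0 m k" by (rule of_type_full_support[OF f0(2) mk])
  obtain c where c: "c \<in> J" "J = ideal.span (insert c ?\<Gamma>)"
    by (rule ideal_eq_span_insert[OF dedekind subspace_Gamma_ideal J Gamma_ideal_nonzero[OF vanishing]])
  define C where "C = ideal.span (lookup f0 ` (keys f0 - {0}))"
  have C: "ideal.subspace C" unfolding C_def by simp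
  have f0_C: "lookup f0 \<alpha> \<in> C" if "\<alpha> \<noteq> 0" for \<alpha>
  proof (cases "\<alpha> \<in> keys f0")
    case True
    then show ?thesis using that unfolding C_def by (intro ideal.span_base) auto
  next
    case False
    then show ?thesis using ideal.subspace_0[OF C] by (simp add: in_keys_iff)
  qed
  obtain s where s: "s \<in> Pi UNIV S" by (rule exists_point[OF vanishing])
  have "eval s f0 \<in> ?\<Gamma>" using eval_mem_fixed_divisor[OF s] f0(3) by blast
  let ?U = "ideal.span (?\<Gamma> \<union> C)"
  \<comment> \<open>The constant coefficient is a value of \<open>f0\<close>, hence an element of
    \<open>\<Gamma>\<close>, minus a combination of the other coefficients.\<close>
  have "lookup f0 0 \<in> ?U"
  proof -
    have "eval s f0 = lookup f0 0 +
        (\<Sum>\<alpha>\<in>keys f0 - {0}. lookup f0 \<alpha> * (\<Prod>j\<in>UNIV. s j ^ lookup \<alpha> j))"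
      by (subst eval_superset[of "insert 0 (keys f0)"], simp, blast, subst sum.remove[of _ 0]) auto
    then have "lookup f0 0 = eval s f0 -
        (\<Sum>\<alpha>\<in>keys f0 - {0}. (\<Prod>j\<in>UNIV. s j ^ lookup \<alpha> j) * lookup f0 \<alpha>)"
      by (simp add: mult.commute)
    also have "\<dots> \<in> ?U"
      using \<open>eval s f0 \<in> ?\<Gamma>\<close> f0_C
      by (intro ideal.span_diff ideal.span_sum ideal.span_scale) (auto intro: ideal.span_base)
    finally show ?thesis .
  qed
  then have "lookup f0 \<alpha> \<in> ?U" for \<alpha>
    using f0_C[of \<alpha>] by (cases "\<alpha> = 0") (auto intro: ideal.span_base)
  then have "ideal.span (lookup f0 ` keys f0) \<subseteq> ?U" by (intro ideal.span_minimal) auto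
  \<comment> \<open>\<open>\<Gamma> + C\<close> contains all coefficients of the primitive
    \<open>f0\<close>, so it is the whole ring. Splitting this element makes the new constant
    coefficient \<open>1 - y\<close> with \<open>y \<in> C\<close>, and \<open>C\<close> is still
    generated by coefficients of \<open>f\<close>.\<close>
  then have "1 - lookup f0 0 - c \<in> ?U" using f0(1) unfolding primitive_def by blast
  then obtain \<gamma> y where gy: "\<gamma> \<in> ?\<Gamma>" "y \<in> C" "1 - lookup f0 0 - c = \<gamma> + y"
    unfolding ideal.span_Un using subspace_Gamma_ideal[of m k S] C
    by (auto simp: ideal.span_eq_iff[THEN iffD2])
  define f where "f = f0 + Const (c + \<gamma>)"
  have lookup_f: "lookup f \<alpha> = (if \<alpha> = 0 then 1 - y else lookup f0 \<alpha>)" for \<alpha>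
    using gy(3) unfolding f_def by (auto simp: lookup_add lookup_Const algebra_simps)
  have prim: "primitive f" unfolding primitive_iff
  proof (intro allI impI, rule ccontr)
    fix P :: "'a set" assume P: "prime_ideal P" and "\<not> (\<exists>\<alpha>. lookup f \<alpha> \<notin> P)"
    then have in_P: "lookup f \<alpha> \<in> P" for \<alpha> by blast
    have "lookup f0 ` (keys f0 - {0}) \<subseteq> P" using in_P lookup_f by (metis DiffE image_subsetI insertI1)
    then have "C \<subseteq> P" unfolding C_def using prime_idealD(1)[OF P] by (rule ideal.span_minimal)
    then have "1 - y + y \<in> P"
      using in_P[of 0] gy(2) ideal.subspace_add[OF prime_idealD(1)[OF P], of "1 - y" y]
      by (auto simp: lookup_f)
    then show False using prime_idealD(2)[OF P] by simp
  qed
  \<comment> \<open>The constant term may disappear, but positive degrees are attained at nonzero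
    exponents only, so the type survives.\<close>
  have "i \<in> supp f" if "i \<in> supp f0" "i \<noteq> (\<lambda>_. 0)" for i
  proof -
    obtain \<alpha> where \<alpha>: "i = lookup \<alpha>" "\<alpha> \<in> keys f0" using \<open>i \<in> supp f0\<close> by blast
    then have "\<alpha> \<noteq> 0" using that(2) by (auto simp: fun_eq_iff)
    then have "\<alpha> \<in> keys f" using \<alpha>(2) by (simp add: in_keys_iff lookup_f)
    then show ?thesis using \<alpha>(1) by blast
  qed
  moreover have supp_f: "supp f \<subseteq> multi_indices m k"
  proof
    fix i assume "i \<in> supp f"
    then obtain \<alpha> where \<alpha>: "i = lookup \<alpha>" "\<alpha> \<in> keys f" by blast
    show "i \<in> multi_indices m k"
    proof (cases "\<alpha> = 0")
      case True
      then show ?thesis using \<alpha>(1) zero_mem_multi_indices[of m k] by (simp add: lookup_zero[abs_def])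
    next
      case False
      then have "\<alpha> \<in> keys f0" using \<alpha>(2) by (simp add: in_keys_iff lookup_f)
      then show ?thesis using \<alpha>(1) f0(2) by blast
    qed
  qed
  ultimately have type: "of_type f m k"
    using type0 unfolding of_type_iff by (metis (mono_tags, lifting) sum.neutral_const)
  have sub: "?\<Gamma> \<subseteq> fixed_divisor S f" by (rule Gamma_ideal_subset_fixed_divisor[OF prim supp_f])
  have "fixed_divisor S f \<subseteq> J"
    unfolding fixed_divisor_def
  proof (rule ideal.span_minimal[OF _ J(1)], clarify)
    fix x assume x: "x \<in> Pi UNIV S"
    have "eval x f0 \<in> J" "\<gamma> \<in> J" using eval_mem_fixed_divisor[OF x] f0(3) J(2) gy(1) by blast+
    then show "eval x f \<in> J" unfolding f_def
      using c(1) J(1) by (simp add: ideal.subspace_add)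
  qed
  moreover have "c \<in> fixed_divisor S f"
  proof -
    have "eval s f \<in> fixed_divisor S f" by (rule eval_mem_fixed_divisor[OF s])
    moreover have "c = eval s f - eval s f0 - \<gamma>" unfolding f_def by simp
    ultimately show ?thesis
      using sub \<open>eval s f0 \<in> ?\<Gamma>\<close> gy(1) ideal.subspace_diff[OF subspace_fixed_divisor[of S f]]
      by (metis subsetD)
  qed
  then have "J \<subseteq> fixed_divisor S f"
    unfolding c(2) using sub by (intro ideal.span_minimal subspace_fixed_divisor) auto
  ultimately show ?thesis using that prim type by blast
qed

end

section \<open>Expansions along I-orderings\<close>

text \<open>Only the power of \<open>P\<close> itself in the factorization of \<open>I\<close> lies
  inside \<open>P\<close>; the remaining factors supply an \<open>x \<notin> P\<close> that carries
  \<open>P ^ (e i + 1)\<close> into \<open>P * I\<close>.\<close>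

lemma I_ordering_local:
  assumes dedekind: "dedekind_domain TYPE('a::idom)"
    and "I_ordering I T (a :: nat \<Rightarrow> 'a)" and P: "prime_ideal P" and "I \<subseteq> P"
  obtains c where "P \<noteq> {0}" "P_ordering P T c" "\<And>t. a t - c t \<in> loc P (ideal.span (P * I))"
proof -
  obtain r Q e where "\<forall>i<(r::nat). prime_ideal (Q i) \<and> Q i \<noteq> {0} \<and> e i \<ge> 1"
    and inj: "inj_on Q {..<r}" and I: "I = ideal.span (\<Prod>i<r. Q i ^ e i)"
    and "\<forall>i<r. \<exists>c. P_ordering (Q i) T c \<and> (\<forall>j. a j - c j \<in> ideal_power (Q i) (e i + 1))"
    using assms(2) unfolding I_ordering_def by (elim exE conjE) (rule that)
  then have Q: "\<And>i. i < r \<Longrightarrow> prime_ideal (Q i) \<and> Q i \<noteq> {0}"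
    and c: "\<And>i. i < r \<Longrightarrow> \<exists>c. P_ordering (Q i) T c \<and> (\<forall>j. a j - c j \<in> ideal_power (Q i) (e i + 1))"
    by simp_all
  have Q_P: "Q i = P" if i: "i < r" "Q i ^ e i \<subseteq> P" for i
  proof -
    have "Q i \<subseteq> P"
    proof
      fix q assume "q \<in> Q i"
      then have "q ^ e i \<in> P" using power_mem_set_power i(2) by blast
      then show "q \<in> P" using prime_ideal_power[OF P] by blast
    qed
    then show ?thesis using prime_ideal_subset_eq[OF dedekind, of "Q i" P] Q[OF i(1)] P by auto
  qed
  have "(\<Prod>i<r. Q i ^ e i) \<subseteq> P" using I \<open>I \<subseteq> P\<close> ideal.span_superset by blast
  then obtain i where i: "i < r" "Q i ^ e i \<subseteq> P"
    using prod_sets_not_subset_prime[OF P, of "{..<r}" "\<lambda>i. Q i ^ e i"]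
    by (metis finite_lessThan lessThan_iff subsetD)
  have "\<not> Q l ^ e l \<subseteq> P" if "l \<in> {..<r} - {i}" for l
    using Q_P[of l] Q_P[OF i] inj that i(1) unfolding inj_on_def by auto
  then obtain x where x: "x \<in> (\<Prod>l\<in>{..<r} - {i}. Q l ^ e l)" "x \<notin> P"
    using prod_sets_not_subset_prime[OF P, of "{..<r} - {i}" "\<lambda>i. Q i ^ e i"] by blast
  have "x * y \<in> P * I" if y: "y \<in> P ^ (e i + 1)" for y
  proof -
    obtain p z where pz: "p \<in> P" "z \<in> P ^ e i" "y = p * z" using y by (auto elim!: set_times_elim)
    have "z * x \<in> P ^ e i * (\<Prod>l\<in>{..<r} - {i}. Q l ^ e l)" using pz(2) x(1) by auto
    also have "\<dots> = (\<Prod>l<r. Q l ^ e l)"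
      using i(1) Q_P[OF i] by (simp add: prod.remove[of "{..<r}" i])
    finally have "z * x \<in> I" unfolding I by (rule ideal.span_base)
    then have "p * (z * x) \<in> P * I" using pz(1) by auto
    then show ?thesis using pz(3) by (simp add: ac_simps)
  qed
  then have "P ^ (e i + 1) \<subseteq> {y. x * y \<in> ideal.span (P * I)}" using ideal.span_base by blast
  moreover have "ideal.subspace {y. x * y \<in> ideal.span (P * I)}"
    by (rule ideal.subspaceI)
      (auto simp: distrib_left mult.left_commute[of x] ideal.span_zero intro: ideal.span_add ideal.span_scale)
  ultimately have sub: "ideal_power P (e i + 1) \<subseteq> {y. x * y \<in> ideal.span (P * I)}"
    unfolding ideal_power_def by (rule ideal.span_minimal)
  obtain c where "P_ordering P T c" "\<And>j. a j - c j \<in> ideal_power P (e i + 1)"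
    using c[OF i(1)] unfolding Q_P[OF i] by blast
  moreover then have "a j - c j \<in> loc P (ideal.span (P * I))" for j
    using sub x(2) by (intro locI[of x]) auto
  moreover have "P \<noteq> {0}" using Q[OF i(1)] Q_P[OF i] by simp
  ultimately show ?thesis using that by blast
qed

context
  fixes S :: "'n::finite \<Rightarrow> 'a::idom set"
  assumes dedekind: "dedekind_domain TYPE('a)"
    and vanishing: "vanishing_ideal S = {0}"
begin

text \<open>Both claims split over the coordinates, where each \<open>c j\<close> is a
  \<open>P\<close>-ordering of an infinite set.\<close>

lemma P_orderings_basis:
  assumes P: "prime_ideal P" "P \<noteq> {0}" and c: "\<And>j. P_ordering P (S j) (c j)"
  shows "pivot c i \<noteq> 0"
    and "\<exists>s. s \<notin> P \<and> (\<forall>x\<in>Pi UNIV S. pivot c i dvd s * eval x (basis_mpoly c i))"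
proof -
  show "pivot c i \<noteq> 0"
    unfolding pivot_def eval_basis_mpoly node_def
    using P_ordering_dvd(1)[OF dedekind P c infinite_factor[OF vanishing]] by simp
  have "\<forall>j. \<exists>s. s \<notin> P \<and> (\<forall>x\<in>S j. (\<Prod>t<i j. c j (i j) - c j t) dvd s * (\<Prod>t<i j. x - c j t))"
    using P_ordering_dvd(2)[OF dedekind P c infinite_factor[OF vanishing]] by blast
  then obtain s where s: "\<And>j. s j \<notin> P"
    "\<And>j x. x \<in> S j \<Longrightarrow> (\<Prod>t<i j. c j (i j) - c j t) dvd s j * (\<Prod>t<i j. x - c j t)" by metis
  have "pivot c i dvd (\<Prod>j\<in>UNIV. s j) * eval x (basis_mpoly c i)" if "x \<in> Pi UNIV S" for x
    unfolding pivot_def eval_basis_mpoly node_def prod.distrib[symmetric]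
    using that by (intro prod_dvd_prod s(2)) auto
  moreover have "(\<Prod>j\<in>UNIV. s j) \<notin> P" using s(1) by (intro prime_ideal_prod[OF P(1)])
  ultimately show "\<exists>s. s \<notin> P \<and> (\<forall>x\<in>Pi UNIV S. pivot c i dvd s * eval x (basis_mpoly c i))"
    by blast
qed

text \<open>At a prime containing \<open>\<Gamma>\<close>, the points \<open>a\<close> may be replaced by \<open>P\<close>-orderings \<open>c\<close>, since both
  agree modulo \<open>P \<Gamma>\<close>. At the other primes all ideals in question are trivial.\<close>

lemma fixed_divisor_expansion:
  fixes f :: "('n, 'a) mpoly"
  assumes \<Gamma>_f: "Gamma_ideal m k S \<subseteq> fixed_divisor S f"
    and a: "\<And>j. I_ordering (Gamma_ideal m k S) (S j) (a j)"
    and f: "f = (\<Sum>i\<in>multi_indices m k. Const (b i) * basis_mpoly a i)"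
  shows "fixed_divisor S f =
    ideal.span (\<Union>i\<in>multi_indices m k. b i *o Gamma_ideal i (\<Sum>j\<in>UNIV. i j) S)"
proof -
  let ?\<Gamma> = "Gamma_ideal m k S"
  let ?M = "multi_indices m k"
  let ?G = "\<lambda>i. Gamma_ideal i (\<Sum>j\<in>UNIV. i j) S"
  let ?d = "fixed_divisor S f"
  let ?E = "ideal.span (\<Union>i\<in>?M. b i *o ?G i)"
  have \<Gamma>_G: "?\<Gamma> \<subseteq> ?G i" if "i \<in> ?M" for i
    using that multi_indices_down by (intro Gamma_ideal_antimono) (auto simp: multi_indices_self)
  have G_E: "b i * \<gamma> \<in> ?E" if "i \<in> ?M" "\<gamma> \<in> ?G i" for i \<gamma>
    using that by (intro ideal.span_base) auto
  have eval_f: "eval x f = (\<Sum>i\<in>?M. b i * eval x (basis_mpoly a i))" for x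
    unfolding f by simp
  \<comment> \<open>The conjuncts are the two inclusions at \<open>P\<close>, tested on generators:
    the values of \<open>f\<close>, and the products \<open>b i * \<gamma>\<close>.\<close>
  have local: "(\<forall>x\<in>Pi UNIV S. eval x f \<in> loc P ?E) \<and> (\<forall>i\<in>?M. \<forall>\<gamma>\<in>?G i. b i * \<gamma> \<in> loc P ?d)"
    if P: "prime_ideal P" for P
  proof (cases "?\<Gamma> \<subseteq> P")
    case False
    then obtain s where s: "s \<in> ?\<Gamma>" "s \<notin> P" by blast
    have "eval x f \<in> loc P ?E" for x
    proof (rule locI[OF s(2)])
      have "s * eval x f = (\<Sum>i\<in>?M. eval x (basis_mpoly a i) * (b i * s))"
        unfolding eval_f sum_distrib_left by (intro sum.cong) (simp_all add: ac_simps)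
      also have "\<dots> \<in> ?E" using \<Gamma>_G s(1) by (intro ideal.span_sum ideal.span_scale[of "_ * s"] G_E) auto
      finally show "s * eval x f \<in> ?E" .
    qed
    moreover have "x \<in> loc P ?d" for x
    proof (rule locI[OF s(2)])
      have "x * s \<in> ?d" using s(1) \<Gamma>_f by (intro ideal.subspace_scale subspace_fixed_divisor) auto
      then show "s * x \<in> ?d" by (simp add: mult.commute)
    qed
    ultimately show ?thesis by blast
  next
    case True
    define Q where "Q = loc P (ideal.span (P * ?\<Gamma>))"
    have Q: "ideal.subspace Q" unfolding Q_def by (intro subspace_loc P ideal.subspace_span)
    have "\<forall>j. \<exists>c. P_ordering P (S j) c \<and> (\<forall>t. a j t - c t \<in> Q)"
      using I_ordering_local[OF dedekind a P True] unfolding Q_def by metis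
    then obtain c where c: "\<And>j. P_ordering P (S j) (c j)" "\<And>j t. a j t - c j t \<in> Q" by metis
    have P0: "P \<noteq> {0}" using I_ordering_local[OF dedekind a P True] by metis
    have c_S: "c j t \<in> S j" for j t using c(1) unfolding P_ordering_def by blast
    let ?D = "\<lambda>i. {x. pivot c i dvd x}"
    have D: "pivot c i \<noteq> 0"
      "\<exists>s. s \<notin> P \<and> (\<forall>x\<in>Pi UNIV S. pivot c i dvd s * eval x (basis_mpoly c i))" for i
      using P_orderings_basis[OF P P0 c(1)] by blast+
    have node_S: "node c i \<in> Pi UNIV S" for i using c_S by (simp add: node_def)
    have eval_D: "eval x (basis_mpoly c i) \<in> loc P (?D i)" if "x \<in> Pi UNIV S" for x i
      using D(2)[of i] that by (auto intro: locI)
    \<comment> \<open>With \<open>D_G\<close> below, \<open>?G i\<close> and the principal ideal of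
      \<open>pivot c i\<close> coincide at \<open>P\<close>. This inclusion holds because
      \<open>basis_mpoly c i\<close> divided by its pivot is locally integer-valued; the other comes
      from triangularity.\<close>
    have G_D: "?G i \<subseteq> loc P (?D i)" for i
    proof
      fix \<gamma> assume \<gamma>: "\<gamma> \<in> ?G i"
      obtain s where "s \<notin> P" "\<And>x. x \<in> Pi UNIV S \<Longrightarrow> pivot c i dvd s * eval x (basis_mpoly c i)"
        using D(2) by blast
      then show "\<gamma> \<in> loc P (?D i)" using pivot_dvd_Gamma_ideal[OF D(1) _ \<gamma>] by (intro locI) auto
    qed
    have D_G: "loc P (?D i) \<subseteq> loc P (?G i)" for i
    proof -
      have "\<exists>s. s \<notin> P \<and> pivot c l dvd s * eval (node c n) (basis_mpoly c l)" for l n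
        using D(2)[of l] node_S[of n] by blast
      then have "pivot c i \<in> loc P (?G i)" by (intro pivot_mem_loc_Gamma_ideal[OF P c_S])
      then have "?D i \<subseteq> loc P (?G i)"
        using ideal.subspace_scale[OF subspace_loc[OF P subspace_Gamma_ideal]]
        by (auto simp: mult.commute[of "pivot c i"] elim!: dvdE)
      then show ?thesis using loc_mono[of _ "loc P (?G i)" P] loc_loc[OF P] by blast
    qed
    \<comment> \<open>Locally \<open>\<Gamma>\<close> lies in \<open>?G i\<close>, hence in the
      ideal of \<open>pivot c i\<close>; the extra factor \<open>P\<close> in \<open>Q\<close> turns
      into a cofactor from \<open>P\<close>.\<close>
    have Q_D: "\<exists>s. s \<notin> P \<and> (\<exists>p\<in>P. s * q = p * pivot c i)" if q: "q \<in> Q" and i: "i \<in> ?M" for q i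
    proof -
      let ?K = "(\<lambda>p. p * pivot c i) ` P"
      have P_sub: "ideal.subspace P" by (rule prime_idealD(1)[OF P])
      have K: "ideal.subspace ?K"
      proof (rule ideal.subspaceI)
        show "0 \<in> ?K" using prime_ideal_zero[OF P] by (auto intro: image_eqI[of _ _ 0])
      next
        fix x y assume "x \<in> ?K" "y \<in> ?K"
        then show "x + y \<in> ?K" using ideal.subspace_add[OF P_sub] by (auto simp flip: distrib_right)
      next
        fix r x assume "x \<in> ?K"
        then show "r * x \<in> ?K" using ideal.subspace_scale[OF P_sub] by (auto simp flip: mult.assoc)
      qed
      have "P * ?\<Gamma> \<subseteq> loc P ?K"
      proof
        fix x assume "x \<in> P * ?\<Gamma>"
        then obtain p \<gamma> where p: "p \<in> P" "\<gamma> \<in> ?\<Gamma>" "x = p * \<gamma>" by (auto elim!: set_times_elim)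
        have "\<gamma> \<in> loc P (?D i)" using p(2) \<Gamma>_G[OF i] G_D by blast
        then obtain s v where s: "s \<notin> P" "s * \<gamma> = pivot c i * v" by (auto elim!: locE dvdE)
        have "s * x = (v * p) * pivot c i" using s(2) p(3) by (simp add: algebra_simps)
        then show "x \<in> loc P ?K" using s(1) ideal.subspace_scale[OF P_sub p(1)] by (intro locI) auto
      qed
      then have "ideal.span (P * ?\<Gamma>) \<subseteq> loc P ?K" by (intro ideal.span_minimal subspace_loc P K)
      then have "Q \<subseteq> loc P ?K" unfolding Q_def using loc_mono loc_loc[OF P] by metis
      then have "q \<in> loc P ?K" using q by blast
      then obtain s where "s \<notin> P" "s * q \<in> ?K" by (rule locE)
      then show ?thesis by blast
    qed
    have Q_loc_D: "Q \<subseteq> loc P (?D i)" if i: "i \<in> ?M" for i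
    proof
      fix q assume "q \<in> Q"
      then obtain s p where "s \<notin> P" "s * q = p * pivot c i" using Q_D[OF _ i] by blast
      then show "q \<in> loc P (?D i)" by (intro locI[of s]) simp_all
    qed
    \<comment> \<open>The value at \<open>x\<close> for the points \<open>a\<close> agrees modulo
      \<open>Q\<close> with the value at \<open>y \<in> S\<close> for the points \<open>c\<close>,
      and the pivot divides both the latter and \<open>Q\<close> locally. Having \<open>x\<close>
      only near \<open>S\<close> allows the nodes of \<open>a\<close>.\<close>
    have eval_a: "eval x (basis_mpoly a i) \<in> loc P (?D i)"
      if "y \<in> Pi UNIV S" "i \<in> ?M" "\<And>j. x j - y j \<in> Q" for x y i
    proof -
      have "eval x (basis_mpoly a i) - eval y (basis_mpoly c i) \<in> loc P (?D i)"
        by (rule subsetD[OF Q_loc_D[OF that(2)]], rule basis_mpoly_cong_ideal[OF Q])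
          (rule that(3), rule c(2))
      then have "eval x (basis_mpoly a i) - eval y (basis_mpoly c i) + eval y (basis_mpoly c i) \<in> loc P (?D i)"
        using eval_D[OF that(1)] by (intro ideal.subspace_add subspace_loc P subspace_principal)
      then show ?thesis by simp
    qed
    have "eval x f \<in> loc P ?E" if x: "x \<in> Pi UNIV S" for x
      unfolding eval_f
    proof (intro ideal.subspace_sum subspace_loc P ideal.subspace_span)
      fix i assume i: "i \<in> ?M"
      have "eval x (basis_mpoly a i) \<in> loc P (?G i)"
        by (rule subsetD[OF D_G], rule eval_a[OF x i]) (simp add: ideal.subspace_0[OF Q])
      then obtain s where s: "s \<notin> P" "s * eval x (basis_mpoly a i) \<in> ?G i" by (rule locE)
      have "s * (b i * eval x (basis_mpoly a i)) = b i * (s * eval x (basis_mpoly a i))"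
        by (simp add: ac_simps)
      also have "\<dots> \<in> ?E" by (rule G_E[OF i s(2)])
      finally show "b i * eval x (basis_mpoly a i) \<in> loc P ?E" by (rule locI[OF s(1)])
    qed
    moreover have "b i * \<gamma> \<in> loc P ?d" if "i \<in> ?M" "\<gamma> \<in> ?G i" for i \<gamma>
    proof -
      have d: "ideal.subspace (loc P ?d)" by (intro subspace_loc P subspace_fixed_divisor)
      have mult_D: "b l * z \<in> loc P ?d" if l: "b l * pivot c l \<in> loc P ?d" "z \<in> loc P (?D l)" for l z
      proof -
        obtain s v where s: "s \<notin> P" "s * z = pivot c l * v" using l(2) by (auto elim!: locE dvdE)
        have "s * (b l * z) = b l * (s * z)" by (simp add: ac_simps)
        also have "\<dots> = v * (b l * pivot c l)" unfolding s(2) by (simp add: ac_simps)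
        also have "\<dots> \<in> loc P ?d" by (rule ideal.subspace_scale[OF d l(1)])
        finally show ?thesis by (rule loc_scale[OF P s(1)])
      qed
      \<comment> \<open>Forward substitution at the nodes of \<open>a\<close>: terms with smaller
        index are known by induction, and those whose index is not below \<open>i\<close>
        vanish.\<close>
      have "b i * pivot c i \<in> loc P ?d" using that(1)
      proof (induction i rule: measure_induct_rule[of "\<lambda>l. \<Sum>j\<in>UNIV. l j"])
        case (less i)
        have node_Q: "node a i j - node c i j \<in> Q" for j unfolding node_def by (rule c(2))
        \<comment> \<open>The node of \<open>a\<close> may lie outside \<open>S\<close>. It agrees
          modulo \<open>Q\<close> with a node in \<open>S\<close>, and \<open>Q\<close> is locally
          inside the fixed divisor because \<open>\<Gamma>\<close> is.\<close>
        have "?\<Gamma> \<subseteq> loc P ?d" using \<Gamma>_f loc_superset[OF P, of ?d] by blast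
        then have "P * ?\<Gamma> \<subseteq> loc P ?d"
          using ideal.subspace_scale[OF d] by (auto elim!: set_times_elim)
        then have "ideal.span (P * ?\<Gamma>) \<subseteq> loc P ?d" by (rule ideal.span_minimal[OF _ d])
        then have "Q \<subseteq> loc P ?d" unfolding Q_def using loc_mono loc_loc[OF P] by metis
        then have "eval (node a i) f - eval (node c i) f \<in> loc P ?d"
          using eval_cong_ideal[OF Q, of "node a i" "node c i" f] node_Q by blast
        moreover have "eval (node c i) f \<in> loc P ?d"
          using eval_mem_fixed_divisor[OF node_S] loc_superset[OF P] by blast
        ultimately have "eval (node a i) f - eval (node c i) f + eval (node c i) f \<in> loc P ?d"
          by (rule ideal.subspace_add[OF d])
        then have "eval (node a i) f \<in> loc P ?d" by simp
        moreover have "b l * eval (node a i) (basis_mpoly a l) \<in> loc P ?d" if l: "l \<in> ?M - {i}" for l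
        proof (cases "l \<le> i")
          case True
          then have "b l * pivot c l \<in> loc P ?d" using l less.IH[of l] sum_strict_less[of l i] by auto
          moreover have "eval (node a i) (basis_mpoly a l) \<in> loc P (?D l)"
            by (rule eval_a[OF node_S]) (use l node_Q in auto)
          ultimately show ?thesis by (rule mult_D)
        next
          case False
          then show ?thesis using ideal.subspace_0[OF d] by (simp add: eval_node_basis_zero)
        qed
        then have "(\<Sum>l\<in>?M - {i}. b l * eval (node a i) (basis_mpoly a l)) \<in> loc P ?d"
          by (rule ideal.subspace_sum[OF d])
        moreover have "eval (node a i) f = b i * pivot a i +
            (\<Sum>l\<in>?M - {i}. b l * eval (node a i) (basis_mpoly a l))"
          unfolding eval_f pivot_def by (rule sum.remove[OF finite_multi_indices less.prems])
        ultimately have piv: "b i * pivot a i \<in> loc P ?d"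
          using ideal.subspace_diff[OF d] by (metis add_diff_cancel_right')
        have "pivot a i - pivot c i \<in> Q"
          unfolding pivot_def by (rule basis_mpoly_cong_ideal[OF Q]) (rule node_Q, rule c(2))
        then obtain s p where s: "s \<notin> P" "p \<in> P" "s * (pivot a i - pivot c i) = p * pivot c i"
          using Q_D[OF _ less.prems] by blast
        \<comment> \<open>Since \<open>p \<in> P\<close>, the factor \<open>s + p\<close> stays
          outside \<open>P\<close>, so the two pivots are associated locally.\<close>
        have eq: "(s + p) * (b i * pivot c i) = s * (b i * pivot a i)"
          using arg_cong[OF s(3), of "\<lambda>x. b i * x"] by (simp add: algebra_simps)
        have "s + p \<notin> P"
          using s(1,2) ideal.subspace_diff[OF prime_idealD(1)[OF P], of "s + p" p] by auto
        moreover have "(s + p) * (b i * pivot c i) \<in> loc P ?d"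
          unfolding eq by (rule ideal.subspace_scale[OF d piv])
        ultimately show ?case by (rule loc_scale[OF P])
      qed
      moreover have "\<gamma> \<in> loc P (?D i)" using that(2) G_D by blast
      ultimately show ?thesis by (rule mult_D)
    qed
    ultimately show ?thesis by blast
  qed
  show ?thesis
  proof
    have "eval x f \<in> ?E" if "x \<in> Pi UNIV S" for x
      using local that by (intro mem_ideal_local[OF dedekind ideal.subspace_span]) blast
    then show "?d \<subseteq> ?E" unfolding fixed_divisor_def
      by (intro ideal.span_minimal ideal.subspace_span) blast
    have "b i * \<gamma> \<in> ?d" if "i \<in> ?M" "\<gamma> \<in> ?G i" for i \<gamma>
      using local that by (intro mem_ideal_local[OF dedekind subspace_fixed_divisor]) blast
    then show "?E \<subseteq> ?d"
      by (intro ideal.span_minimal subspace_fixed_divisor) (auto simp: elt_set_times_def)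
  qed
qed

end

theorem theorem4p2:
  fixes S :: "'n::finite \<Rightarrow> 'a::idom set" and m :: "'n \<Rightarrow> nat" and k :: nat
  assumes "dedekind_domain TYPE('a)"
    and "vanishing_ideal S = {0}"
  shows "(\<forall>(f :: ('n, 'a) mpoly) a.
            primitive f \<and> of_type f m k \<and>
            (\<forall>j. I_ordering (fixed_divisor S f \<inter> Gamma_ideal m k S) (S j) (a j)) \<longrightarrow>
              (\<exists>b. f = (\<Sum>i\<in>multi_indices m k. Const (b i) * basis_mpoly a i)) \<and>
              (\<forall>b. f = (\<Sum>i\<in>multi_indices m k. Const (b i) * basis_mpoly a i) \<longrightarrow>
                 fixed_divisor S f =
                   ideal.span (\<Union>i\<in>multi_indices m k. b i *o Gamma_ideal i (\<Sum>j\<in>UNIV. i j) S)))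
       \<and> (\<forall>f :: ('n, 'a) mpoly. primitive f \<and> of_type f m k \<longrightarrow>
            ideal_dvd (fixed_divisor S f) (Gamma_ideal m k S))
       \<and> (Max (range m) \<le> k \<and> k \<le> (\<Sum>j\<in>UNIV. m j) \<longrightarrow>
            (\<exists>f :: ('n, 'a) mpoly. primitive f \<and> of_type f m k \<and>
               fixed_divisor S f = Gamma_ideal m k S))
       \<and> (Max (range m) \<le> k \<and> k \<le> (\<Sum>j\<in>UNIV. m j) \<longrightarrow>
            (\<forall>J. ideal.subspace J \<and> ideal_dvd J (Gamma_ideal m k S) \<longrightarrow>
               (\<exists>f :: ('n, 'a) mpoly. primitive f \<and> of_type f m k \<and> fixed_divisor S f = J)))"
proof -
  let ?\<Gamma> = "Gamma_ideal m k S"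
  have dvd: "?\<Gamma> \<subseteq> fixed_divisor S f" if "primitive f" "of_type f m k" for f :: "('n, 'a) mpoly"
    using that by (intro Gamma_ideal_subset_fixed_divisor[OF assms]) (simp_all add: of_type_iff)
  have expansion: "(\<exists>b. f = (\<Sum>i\<in>multi_indices m k. Const (b i) * basis_mpoly a i)) \<and>
      (\<forall>b. f = (\<Sum>i\<in>multi_indices m k. Const (b i) * basis_mpoly a i) \<longrightarrow>
        fixed_divisor S f =
          ideal.span (\<Union>i\<in>multi_indices m k. b i *o Gamma_ideal i (\<Sum>j\<in>UNIV. i j) S))"
    if f: "primitive f" "of_type f m k" "\<And>j. I_ordering (fixed_divisor S f \<inter> ?\<Gamma>) (S j) (a j)"
    for f :: "('n, 'a) mpoly" and a
  proof (intro conjI allI impI)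
    have "supp f \<subseteq> multi_indices m k" using f(2) by (simp add: of_type_iff)
    then show "\<exists>b. f = (\<Sum>i\<in>multi_indices m k. Const (b i) * basis_mpoly a i)"
      using basis_expansion[of f m k a] by blast
  next
    fix b assume b: "f = (\<Sum>i\<in>multi_indices m k. Const (b i) * basis_mpoly a i)"
    have "fixed_divisor S f \<inter> ?\<Gamma> = ?\<Gamma>" using dvd[OF f(1,2)] by blast
    then show "fixed_divisor S f =
        ideal.span (\<Union>i\<in>multi_indices m k. b i *o Gamma_ideal i (\<Sum>j\<in>UNIV. i j) S)"
      using fixed_divisor_expansion[OF assms dvd[OF f(1,2)] _ b] f(3) by simp
  qed
  have exists: "\<exists>f :: ('n, 'a) mpoly. primitive f \<and> of_type f m k \<and> fixed_divisor S f = J"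
    if "Max (range m) \<le> k" "k \<le> (\<Sum>j\<in>UNIV. m j)" "ideal.subspace J" "?\<Gamma> \<subseteq> J" for J
    using exists_primitive_fixed_divisor[OF assms that(3,4,1,2)] by blast
  show ?thesis
    using expansion dvd exists exists[OF _ _ subspace_Gamma_ideal order_refl]
    unfolding ideal_dvd_def by (intro conjI allI impI) blast+
qed

end
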